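(* Let $X$ be a connected non-orientable smooth manifold of even dimension $2n$ without boundary, with a Riemannian metric $g$, and let $\pi:\tilde X\to X$ be its orientable double cover, with metric $\pi^*g$ and sheet-exchange involution $\tau$. Fix a sign $\pm$ and let $\tilde\xi:P_{\mathrm{Pin}^\pm}\tilde X\to P_O\tilde X$ be a $\tau$-invariant pin$^\pm$ structure on $\tilde X$ whose lifts $\widetilde{d\tau}$, $\widetilde{d\tau}\circ\gamma$ of $d\tau$ have square $\mathrm{id}$. Let $S=P_{\mathrm{Pin}^\pm}\tilde X\times_\rho\mathbb C^{2^n}$ be the associated bundle of pinors. Then there are natural vector space isomorphisms: (1) between the space of sections $s\in\Gamma(S)$ satisfying $s_x=\widetilde{d\tau}(s_{\tau(x)})$ for all $x\in\tilde X$ and the space of sections of the pinor bundle on $X$ of the pin$^\pm$ structure $P_{\mathrm{Pin}^\pm}\tilde X/\widetilde{d\tau}$; (2) between the space of sections $s\in\Gamma(S)$ satisfying $s_x=-\widetilde{d\tau}(s_{\tau(x)})$ for all $x\in\tilde X$ and the space of sections of the pinor bundle on $X$ of the pin$^\pm$ structure $P_{\mathrm{Pin}^\pm}\tilde X/(\widetilde{d\tau}\circ\gamma)$.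
   Context: $\mathrm{Pin}^{+}(m)$ and $\mathrm{Pin}^-(m)$ are the two double coverings $p^\pm:\mathrm{Pin}^\pm(m)\to O(m)$ with kernel $\{\pm1\}$ built from the Clifford algebras in which unit vectors $v$ satisfy $v^2=+1$, resp. $v^2=-1$. For a Riemannian manifold $M$ of dimension $m$, $P_OM$ is its orthonormal frame bundle. A pin$^\pm$ structure on $M$ is a principal $\mathrm{Pin}^\pm(m)$-bundle $P_{\mathrm{Pin}^\pm}M\to M$ with a 2-covering $\xi:P_{\mathrm{Pin}^\pm}M\to P_OM$ over $M$ satisfying $\xi(p\cdot s)=\xi(p)\cdot p^\pm(s)$. $\gamma$ denotes the exchange of the two sheets of $\xi$, i.e. the action of $-1\in\mathrm{Pin}^\pm(m)$. For an isometry $\varphi$ of $M$, $\xi$ is $\varphi$-invariant if there is a $\mathrm{Pin}^\pm(m)$-equivariant diffeomorphism $\widetilde{d\varphi}$ of $P_{\mathrm{Pin}^\pm}M$ (a lift of $d\varphi$) with $\xi\circ\widetilde{d\varphi}=d\varphi\circ\xi$. For $M$ connected there are then exactly two lifts, $\widetilde{d\varphi}$ and $\widetilde{d\varphi}\circ\gamma$. If $\widetilde{d\tau}^2=\mathrm{id}$, the quotient $P_{\mathrm{Pin}^\pm}\tilde X/\widetilde{d\tau}$ is a pin$^\pm$ structure on $X$ via the map to $P_O\tilde X/d\tau\cong P_OX$ induced by $\tilde\xi$; similarly for $\widetilde{d\tau}\circ\gamma$. $\rho$ is the standard action of $\mathrm{Pin}^\pm(2n)$ on the Clifford module $\mathbb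 C^{2^n}$; the pinor bundle of a pin$^\pm$ structure with total space $P$ is $P\times_\rho\mathbb C^{2^n}$. The lift acts on pinors by $\widetilde{d\tau}[p,v]=[\widetilde{d\tau}(p),v]$, covering $\tau$; the action of $\gamma$ is multiplication by $-1$. *)

theory Defs
  imports "HOL-Analysis.Analysis" "HOL-Algebra.Group"
begin

section \<open>Smooth maps between subsets of normed spaces\<close>

primrec Ck_on :: "nat \<Rightarrow> 'a::real_normed_vector set \<Rightarrow> ('a \<Rightarrow> 'b::real_normed_vector) \<Rightarrow> bool" where
  "Ck_on 0 S f = continuous_on S f"
| "Ck_on (Suc k) S f =
     ((\<forall>x\<in>S. f differentiable (at x)) \<and> (\<forall>v. Ck_on k S (\<lambda>x. frechet_derivative f (at x) v)))"

text \<open>On an arbitrary subset, smooth means: locally the restriction of a smooth map defined on an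
  open set. This is the usual notion both for open subsets and for embedded submanifolds, such as
  the Pin group inside the Clifford algebra.\<close>

definition smooth_on :: "'a::real_normed_vector set \<Rightarrow> ('a \<Rightarrow> 'b::real_normed_vector) \<Rightarrow> bool" where
  "smooth_on S f \<longleftrightarrow>
     (\<forall>x\<in>S. \<exists>W h. open W \<and> x \<in> W \<and> (\<forall>k. Ck_on k W h) \<and> (\<forall>y\<in>W \<inter> S. h y = f y))"


section \<open>Manifolds\<close>

text \<open>A chart is a pair of a domain and a coordinate map. The type of coordinates is arbitrary, so
  that total spaces of principal \<open>G\<close>-bundles, whose charts take values in \<open>\<real>\<^sup>m \<times> G\<close>, can be treated
  together with manifolds modelled on \<open>\<real>\<^sup>m\<close>.\<close>

type_synonym ('a, 'e) chart = "'a set \<times> ('a \<Rightarrow> 'e)"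

record ('a, 'e) mfd =
  mtop :: "'a topology"
  charts :: "('a, 'e) chart set"

type_synonym ('a, 'm) rmfd = "('a, real^'m) mfd"

abbreviation pts :: "('a, 'e, 'z) mfd_scheme \<Rightarrow> 'a set" where
  "pts M \<equiv> topspace (mtop M)"

abbreviation chart_inv :: "('a, 'e) chart \<Rightarrow> 'e \<Rightarrow> 'a" where
  "chart_inv c \<equiv> inv_into (fst c) (snd c)"

definition smooth_manifold :: "('a, real^'m) mfd \<Rightarrow> bool" where
  "smooth_manifold M \<longleftrightarrow>
     Hausdorff_space (mtop M) \<and> second_countable (mtop M) \<and>
     (\<Union>c\<in>charts M. fst c) = pts M \<and>
     (\<forall>c\<in>charts M. openin (mtop M) (fst c) \<and> open (snd c ` fst c) \<and>
        homeomorphic_map (subtopology (mtop M) (fst c)) (top_of_set (snd c ` fst c)) (snd c)) \<and>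
     (\<forall>c\<in>charts M. \<forall>d\<in>charts M. smooth_on (snd c ` (fst c \<inter> fst d)) (snd d \<circ> chart_inv c))"

definition orientable :: "('a, real^'m) mfd \<Rightarrow> bool" where
  "orientable M \<longleftrightarrow>
     (\<exists>A. smooth_manifold (M\<lparr>charts := charts M \<union> A\<rparr>) \<and> (\<Union>c\<in>A. fst c) = pts M \<and>
        (\<forall>c\<in>A. \<forall>d\<in>A. \<forall>x\<in>fst c \<inter> fst d.
           det (matrix (frechet_derivative (snd d \<circ> chart_inv c) (at (snd c x)))) > 0))"

definition smooth_map ::
  "('a, 'e::real_normed_vector) mfd \<Rightarrow> ('b, 'f::real_normed_vector) mfd \<Rightarrow> ('a \<Rightarrow> 'b) \<Rightarrow> bool" where
  "smooth_map M N f \<longleftrightarrow>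
     continuous_map (mtop M) (mtop N) f \<and>
     (\<forall>c\<in>charts M. \<forall>d\<in>charts N.
        smooth_on (snd c ` {x \<in> fst c. f x \<in> fst d}) (snd d \<circ> f \<circ> chart_inv c))"

definition diffeomorphism ::
  "('a, 'e::real_normed_vector) mfd \<Rightarrow> ('b, 'f::real_normed_vector) mfd \<Rightarrow> ('a \<Rightarrow> 'b) \<Rightarrow> bool" where
  "diffeomorphism M N f \<longleftrightarrow>
     bij_betw f (pts M) (pts N) \<and> smooth_map M N f \<and> smooth_map N M (inv_into (pts M) f)"

definition open_submfd :: "('a, 'e) mfd \<Rightarrow> 'a set \<Rightarrow> ('a, 'e) mfd" where
  "open_submfd M U =
     \<lparr>mtop = subtopology (mtop M) U, charts = (\<lambda>c. (fst c \<inter> U, snd c)) ` charts M\<rparr>"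

definition double_covering ::
  "('a, 'e::real_normed_vector) mfd \<Rightarrow> ('b, 'f::real_normed_vector) mfd \<Rightarrow> ('a \<Rightarrow> 'b) \<Rightarrow> bool" where
  "double_covering M N f \<longleftrightarrow>
     smooth_map M N f \<and>
     (\<forall>y\<in>pts N. \<exists>V U1 U2. openin (mtop N) V \<and> y \<in> V \<and>
        openin (mtop M) U1 \<and> openin (mtop M) U2 \<and> U1 \<inter> U2 = {} \<and>
        {x \<in> pts M. f x \<in> V} = U1 \<union> U2 \<and>
        diffeomorphism (open_submfd M U1) (open_submfd N V) f \<and>
        diffeomorphism (open_submfd M U2) (open_submfd N V) f)"

definition smooth_fun_on ::
  "('a, 'e::real_normed_vector) mfd \<Rightarrow> 'a set \<Rightarrow> ('a \<Rightarrow> 'b::real_normed_vector) \<Rightarrow> bool" where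
  "smooth_fun_on M U f \<longleftrightarrow> (\<forall>c\<in>charts M. smooth_on (snd c ` (fst c \<inter> U)) (f \<circ> chart_inv c))"


section \<open>Tangent vectors and Riemannian metrics\<close>

text \<open>A tangent vector at \<open>x\<close> is the family of its coordinate vectors in all charts around \<open>x\<close>,
  transforming by the Jacobians of the coordinate changes (and \<open>0\<close> at all other charts). The vector
  space operations are the pointwise ones.\<close>

type_synonym ('a, 'm) tvec = "('a, real^'m) chart \<Rightarrow> real^'m"

definition charts_at :: "('a, 'e) mfd \<Rightarrow> 'a \<Rightarrow> ('a, 'e) chart set" where
  "charts_at M x = {c \<in> charts M. x \<in> fst c}"

definition coord_vec ::
  "('a, real^'m) mfd \<Rightarrow> ('a, real^'m) chart \<Rightarrow> 'a \<Rightarrow> real^'m \<Rightarrow> ('a, 'm) tvec" where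
  "coord_vec M c x w =
     (\<lambda>d. if d \<in> charts_at M x then frechet_derivative (snd d \<circ> chart_inv c) (at (snd c x)) w else 0)"

definition tangent_space :: "('a, real^'m) mfd \<Rightarrow> 'a \<Rightarrow> ('a, 'm) tvec set" where
  "tangent_space M x =
     {v. (\<forall>d. d \<notin> charts_at M x \<longrightarrow> v d = 0) \<and> (\<forall>c\<in>charts_at M x. v = coord_vec M c x (v c))}"

definition tangent_map ::
  "('a, real^'m) mfd \<Rightarrow> ('b, real^'k) mfd \<Rightarrow> ('a \<Rightarrow> 'b) \<Rightarrow> 'a \<Rightarrow> ('a, 'm) tvec \<Rightarrow> ('b, 'k) tvec" where
  "tangent_map M N f x v =
     (\<lambda>d. if d \<in> charts_at N (f x)
          then let c = (SOME c. c \<in> charts_at M x)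
               in frechet_derivative (snd d \<circ> f \<circ> chart_inv c) (at (snd c x)) (v c)
          else 0)"

type_synonym ('a, 'm) metric = "'a \<Rightarrow> ('a, 'm) tvec \<Rightarrow> ('a, 'm) tvec \<Rightarrow> real"

definition riemannian_metric :: "('a, real^'m) mfd \<Rightarrow> ('a, 'm) metric \<Rightarrow> bool" where
  "riemannian_metric M g \<longleftrightarrow>
     (\<forall>x\<in>pts M. \<forall>u\<in>tangent_space M x. \<forall>v\<in>tangent_space M x. g x u v = g x v u) \<and>
     (\<forall>x\<in>pts M. \<forall>u\<in>tangent_space M x. \<forall>v\<in>tangent_space M x. \<forall>w\<in>tangent_space M x. \<forall>a.
        g x (\<lambda>c. a *\<^sub>R u c + v c) w = a * g x u w + g x v w) \<and>
     (\<forall>x\<in>pts M. \<forall>u\<in>tangent_space M x. u \<noteq> (\<lambda>c. 0) \<longrightarrow> g x u u > 0) \<and>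
     (\<forall>c\<in>charts M. \<forall>i j. smooth_on (snd c ` fst c)
        ((\<lambda>x. g x (coord_vec M c x (axis i 1)) (coord_vec M c x (axis j 1))) \<circ> chart_inv c))"

definition pullback_metric ::
  "('a, real^'m) mfd \<Rightarrow> ('b, real^'k) mfd \<Rightarrow> ('a \<Rightarrow> 'b) \<Rightarrow> ('b, 'k) metric \<Rightarrow> ('a, 'm) metric" where
  "pullback_metric M N f g = (\<lambda>x u v. g (f x) (tangent_map M N f x u) (tangent_map M N f x v))"


section \<open>Principal bundles\<close>

text \<open>The structure group \<open>G\<close> is a group realised inside a normed vector space. The smooth structure
  of a principal bundle is given by a family of local sections \<open>(U, \<sigma>)\<close> with smooth transition
  functions; equivalently by the local trivialisations \<open>U \<times> G \<rightarrow> P\<close>, \<open>(x, s) \<mapsto> \<sigma>(x) \<cdot> s\<close>.\<close>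

record ('p, 'a, 'g) pbundle =
  total :: "'p set"
  proj :: "'p \<Rightarrow> 'a"
  act :: "'p \<Rightarrow> 'g \<Rightarrow> 'p"
  lsecs :: "('a set \<times> ('a \<Rightarrow> 'p)) set"

definition pdiff :: "'g monoid \<Rightarrow> ('p, 'a, 'g, 'z) pbundle_scheme \<Rightarrow> 'p \<Rightarrow> 'p \<Rightarrow> 'g" where
  "pdiff G P p q = (THE s. s \<in> carrier G \<and> q = act P p s)"

definition principal_bundle ::
  "('a, real^'m) mfd \<Rightarrow> 'g::real_normed_vector monoid \<Rightarrow> ('p, 'a, 'g, 'z) pbundle_scheme \<Rightarrow> bool" where
  "principal_bundle M G P \<longleftrightarrow>
     group G \<and>
     proj P ` total P \<subseteq> pts M \<and>
     (\<forall>p\<in>total P. act P p \<one>\<^bsub>G\<^esub> = p) \<and>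
     (\<forall>p\<in>total P. \<forall>s\<in>carrier G. act P p s \<in> total P \<and> proj P (act P p s) = proj P p) \<and>
     (\<forall>p\<in>total P. \<forall>s\<in>carrier G. \<forall>t\<in>carrier G. act P (act P p s) t = act P p (s \<otimes>\<^bsub>G\<^esub> t)) \<and>
     (\<forall>p\<in>total P. \<forall>q\<in>total P. proj P p = proj P q \<longrightarrow> (\<exists>!s. s \<in> carrier G \<and> q = act P p s)) \<and>
     (\<Union>l\<in>lsecs P. fst l) = pts M \<and>
     (\<forall>(U, \<sigma>)\<in>lsecs P. openin (mtop M) U \<and> (\<forall>x\<in>U. \<sigma> x \<in> total P \<and> proj P (\<sigma> x) = x)) \<and>
     (\<forall>(U, \<sigma>)\<in>lsecs P. \<forall>(V, \<sigma>')\<in>lsecs P.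
        smooth_fun_on M (U \<inter> V) (\<lambda>x. pdiff G P (\<sigma> x) (\<sigma>' x)))"

text \<open>The total space, with the topology and the charts to \<open>\<real>\<^sup>m \<times> G\<close> induced by the local
  trivialisations and the charts of the base.\<close>

definition bundle_open ::
  "('a, real^'m) mfd \<Rightarrow> 'g::real_normed_vector monoid \<Rightarrow> ('p, 'a, 'g, 'z) pbundle_scheme \<Rightarrow> 'p set \<Rightarrow> bool" where
  "bundle_open M G P W \<longleftrightarrow> W \<subseteq> total P \<and>
     (\<forall>(U, \<sigma>)\<in>lsecs P.
        openin (prod_topology (subtopology (mtop M) U) (top_of_set (carrier G)))
          {(x, s). x \<in> pts M \<inter> U \<and> s \<in> carrier G \<and> act P (\<sigma> x) s \<in> W})"

lemma istopology_bundle_open: "istopology (bundle_open M G P)"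
proof -
  have inter: "bundle_open M G P (S \<inter> T)" if "bundle_open M G P S" "bundle_open M G P T" for S T
  proof -
    have eq: "{(x, s). x \<in> pts M \<inter> U \<and> s \<in> carrier G \<and> act P (\<sigma> x) s \<in> S \<inter> T} =
          {(x, s). x \<in> pts M \<inter> U \<and> s \<in> carrier G \<and> act P (\<sigma> x) s \<in> S} \<inter>
          {(x, s). x \<in> pts M \<inter> U \<and> s \<in> carrier G \<and> act P (\<sigma> x) s \<in> T}" for U \<sigma>
      by auto
    show ?thesis
      using that unfolding bundle_open_def eq by (fast intro: openin_Int)
  qed
  have union: "bundle_open M G P (\<Union>K)" if "\<forall>S\<in>K. bundle_open M G P S" for K
  proof -
    have eq: "{(x, s). x \<in> pts M \<inter> U \<and> s \<in> carrier G \<and> act P (\<sigma> x) s \<in> \<Union>K} =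
          (\<Union>S\<in>K. {(x, s). x \<in> pts M \<inter> U \<and> s \<in> carrier G \<and> act P (\<sigma> x) s \<in> S})" for U \<sigma>
      by auto
    show ?thesis
      using that unfolding bundle_open_def eq by (fast intro: openin_Union)
  qed
  show ?thesis
    unfolding istopology_def using inter union by blast
qed

definition total_mfd ::
  "('a, real^'m) mfd \<Rightarrow> 'g::real_normed_vector monoid \<Rightarrow> ('p, 'a, 'g, 'z) pbundle_scheme
     \<Rightarrow> ('p, (real^'m) \<times> 'g) mfd" where
  "total_mfd M G P =
     \<lparr>mtop = topology (bundle_open M G P),
      charts = {({p \<in> total P. proj P p \<in> fst c \<inter> U},
                 \<lambda>p. (snd c (proj P p), pdiff G P (\<sigma> (proj P p)) p)) | c U \<sigma>.
                c \<in> charts M \<and> (U, \<sigma>) \<in> lsecs P}\<rparr>"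


section \<open>The orthonormal frame bundle\<close>

definition orth_group :: "(real^'m^'m) monoid" where
  "orth_group = \<lparr>carrier = {A. orthogonal_matrix A}, mult = (**), one = mat 1\<rparr>"

type_synonym ('a, 'm) frame = "'a \<times> ('m \<Rightarrow> ('a, 'm) tvec)"

definition orthonormal_frames :: "('a, real^'m) mfd \<Rightarrow> ('a, 'm) metric \<Rightarrow> ('a, 'm) frame set" where
  "orthonormal_frames M g =
     {(x, b). x \<in> pts M \<and> (\<forall>i. b i \<in> tangent_space M x) \<and>
              (\<forall>i j. g x (b i) (b j) = (if i = j then 1 else 0))}"

definition frame_bundle ::
  "('a, real^'m) mfd \<Rightarrow> ('a, 'm) metric \<Rightarrow> (('a, 'm) frame, 'a, real^'m^'m) pbundle" where
  "frame_bundle M g =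
     \<lparr>total = orthonormal_frames M g,
      proj = fst,
      act = (\<lambda>(x, b) A. (x, \<lambda>j c. \<Sum>i\<in>UNIV. (A $ i $ j) *\<^sub>R b i c)),
      lsecs = {(U, \<sigma>). openin (mtop M) U \<and>
                 (\<forall>x\<in>U. \<sigma> x \<in> orthonormal_frames M g \<and> fst (\<sigma> x) = x) \<and>
                 (\<forall>c\<in>charts M. \<forall>i.
                    smooth_on (snd c ` (fst c \<inter> U)) ((\<lambda>x. snd (\<sigma> x) i c) \<circ> chart_inv c))}\<rparr>"

definition frame_map ::
  "('a, real^'m) mfd \<Rightarrow> ('b, real^'m) mfd \<Rightarrow> ('a \<Rightarrow> 'b) \<Rightarrow> ('a, 'm) frame \<Rightarrow> ('b, 'm) frame" where
  "frame_map M N f = (\<lambda>(x, b). (f x, \<lambda>i. tangent_map M N f x (b i)))"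


section \<open>Clifford algebras and Pin groups\<close>

text \<open>The real Clifford algebra on orthonormal generators \<open>e\<^sub>i\<close> with \<open>e\<^sub>i\<^sup>2 = \<epsilon>\<close>, in the basis of
  the increasing products \<open>e\<^sub>A\<close> for \<open>A \<subseteq> UNIV\<close>. In \<open>e\<^sub>A e\<^sub>B\<close> a sign arises whenever \<open>e\<^sub>b\<close> is moved
  past \<open>e\<^sub>a\<close> with \<open>b < a\<close>, and a factor \<open>\<epsilon>\<close> for each common index.\<close>

type_synonym 'm cliff = "real^('m set)"

definition cl_sign :: "real \<Rightarrow> 'm::{finite,linorder} set \<Rightarrow> 'm set \<Rightarrow> real" where
  "cl_sign \<epsilon> A B = (\<Prod>a\<in>A. \<Prod>b\<in>B. if b < a then -1 else if a = b then \<epsilon> else 1)"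

definition cl_mult :: "real \<Rightarrow> 'm::{finite,linorder} cliff \<Rightarrow> 'm cliff \<Rightarrow> 'm cliff" where
  "cl_mult \<epsilon> x y =
     (\<Sum>A\<in>UNIV. \<Sum>B\<in>UNIV. (cl_sign \<epsilon> A B * x $ A * y $ B) *\<^sub>R axis ((A - B) \<union> (B - A)) 1)"

definition cl_one :: "'m::{finite,linorder} cliff" where
  "cl_one = axis {} 1"

definition cl_vec :: "real^'m::{finite,linorder} \<Rightarrow> 'm cliff" where
  "cl_vec v = (\<Sum>i\<in>UNIV. (v $ i) *\<^sub>R axis {i} 1)"

lemma prod_symdiff:
  fixes h :: "'a \<Rightarrow> real"
  assumes "finite A" "finite B" "\<And>a. h a * h a = 1"
  shows "prod h ((A - B) \<union> (B - A)) = prod h A * prod h B"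
proof -
  have 1: "prod h A = prod h (A - B) * prod h (A \<inter> B)"
    using prod.Int_Diff[OF assms(1), of h B] by (simp add: mult.commute)
  have 2: "prod h B = prod h (B - A) * prod h (A \<inter> B)"
    using prod.Int_Diff[OF assms(2), of h A] by (simp add: mult.commute Int_commute)
  have 3: "prod h (A \<inter> B) * prod h (A \<inter> B) = 1"
    by (simp add: prod.distrib[symmetric] assms(3))
  have 4: "prod h ((A - B) \<union> (B - A)) = prod h (A - B) * prod h (B - A)"
    by (rule prod.union_disjoint) (use assms in auto)
  have "prod h A * prod h B = prod h (A - B) * prod h (B - A) * (prod h (A \<inter> B) * prod h (A \<inter> B))"
    unfolding 1 2 by (simp only: mult_ac)
  then show ?thesis using 3 4 by simp
qed

lemma cl_sign_symdiff_left:
  assumes "\<epsilon> * \<epsilon> = 1"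
  shows "cl_sign \<epsilon> ((A - B) \<union> (B - A)) C = cl_sign \<epsilon> A C * cl_sign \<epsilon> B C"
  unfolding cl_sign_def
  by (rule prod_symdiff) (auto simp: assms prod.distrib[symmetric] intro!: prod.neutral)

lemma cl_sign_symdiff_right:
  assumes "\<epsilon> * \<epsilon> = 1"
  shows "cl_sign \<epsilon> A ((B - C) \<union> (C - B)) = cl_sign \<epsilon> A B * cl_sign \<epsilon> A C"
  unfolding cl_sign_def prod.distrib[symmetric]
  by (intro prod.cong refl prod_symdiff) (auto simp: assms)

lemma cl_mult_axis:
  "cl_mult \<epsilon> (axis A 1) (axis B 1) = cl_sign \<epsilon> A B *\<^sub>R axis ((A - B) \<union> (B - A)) 1"
proof -
  have "cl_mult \<epsilon> (axis A 1) (axis B 1) = (\<Sum>A'\<in>UNIV. \<Sum>B'\<in>UNIV. if B' = B then if A' = A then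
      cl_sign \<epsilon> A B *\<^sub>R axis ((A - B) \<union> (B - A)) 1 else 0 else 0)"
    unfolding cl_mult_def by (intro sum.cong refl) (auto simp: axis_def)
  then show ?thesis by simp
qed

lemma bilinear_cl_mult: "bilinear (cl_mult \<epsilon>)"
  unfolding bilinear_def cl_mult_def
  by (auto intro!: linearI simp: algebra_simps sum.distrib scaleR_sum_right)

lemma cliff_induct [case_names axis add scale]:
  fixes x :: "'m::{finite,linorder} cliff"
  assumes "\<And>A. Q (axis A 1)" "\<And>x y. Q x \<Longrightarrow> Q y \<Longrightarrow> Q (x + y)" "\<And>r x. Q x \<Longrightarrow> Q (r *\<^sub>R x)"
  shows "Q x"
proof -
  have z: "Q 0" using assms(3)[OF assms(1), of 0] by simp
  have "Q (\<Sum>A\<in>F. x $ A *\<^sub>R axis A 1)" if "finite F" for F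
    using that by (induction F rule: finite_induct) (auto simp: z intro!: assms)
  from this[of UNIV] show ?thesis
    using basis_expansion[of x] by (simp add: scalar_mult_eq_scaleR)
qed

lemma cl_mult_assoc:
  assumes "\<epsilon> * \<epsilon> = 1"
  shows "cl_mult \<epsilon> (cl_mult \<epsilon> x y) z = cl_mult \<epsilon> x (cl_mult \<epsilon> y z)"
proof -
  note b = bilinear_cl_mult[of \<epsilon>]
  note bs = bilinear_ladd[OF b] bilinear_radd[OF b] bilinear_lmul[OF b] bilinear_rmul[OF b]
  show ?thesis
  proof (induction x rule: cliff_induct)
    case (axis A)
    show ?case
    proof (induction y rule: cliff_induct)
      case (axis B)
      show ?case
      proof (induction z rule: cliff_induct)
        case (axis C)
        have "(A - B \<union> (B - A) - C \<union> (C - (A - B \<union> (B - A)))) =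
              (A - (B - C \<union> (C - B)) \<union> (B - C \<union> (C - B) - A))" by blast
        then show ?case
          by (simp add: cl_mult_axis bs cl_sign_symdiff_left[OF assms] cl_sign_symdiff_right[OF assms] mult_ac)
      qed (simp_all add: bs)
    qed (simp_all add: bs)
  qed (simp_all add: bs)
qed

lemma cl_mult_one: "cl_mult \<epsilon> cl_one x = x" "cl_mult \<epsilon> x cl_one = x"
proof -
  note b = bilinear_cl_mult[of \<epsilon>]
  note bs = bilinear_ladd[OF b] bilinear_radd[OF b] bilinear_lmul[OF b] bilinear_rmul[OF b]
  show "cl_mult \<epsilon> cl_one x = x" "cl_mult \<epsilon> x cl_one = x"
    by (induction x rule: cliff_induct) (simp_all add: cl_one_def cl_mult_axis cl_sign_def bs)
qed

lemma cl_vec_square: "cl_mult \<epsilon> (cl_vec v) (cl_vec v) = (\<epsilon> * (norm v)\<^sup>2) *\<^sub>R cl_one"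
proof -
  note b = bilinear_cl_mult[of \<epsilon>]
  define t where "t i j = (v $ i * v $ j) *\<^sub>R cl_mult \<epsilon> (axis {i} 1) (axis {j} 1)" for i j
  have anti: "t j i = - t i j" if "i \<noteq> j" for i j
  proof -
    have "{i} - {j} \<union> ({j} - {i}) = {j} - {i} \<union> ({i} - {j})" by blast
    with that show ?thesis
      by (auto simp: t_def cl_mult_axis cl_sign_def mult.commute)
  qed
  have diag: "t i i = ((v $ i)\<^sup>2 * \<epsilon>) *\<^sub>R cl_one" for i
    by (simp add: t_def cl_mult_axis cl_sign_def cl_one_def power2_eq_square)
  have S: "cl_mult \<epsilon> (cl_vec v) (cl_vec v) = (\<Sum>i\<in>UNIV. \<Sum>j\<in>UNIV. t i j)"
    unfolding cl_vec_def bilinear_sum[OF b] sum.cartesian_product t_def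
    by (intro sum.cong refl) (auto simp: bilinear_lmul[OF b] bilinear_rmul[OF b])
  have "2 *\<^sub>R (\<Sum>i\<in>UNIV. \<Sum>j\<in>UNIV. t i j) = (\<Sum>i\<in>UNIV. \<Sum>j\<in>UNIV. t i j) + (\<Sum>i\<in>UNIV. \<Sum>j\<in>UNIV. t j i)"
    by (subst (3) sum.swap) (simp add: scaleR_2)
  also have "\<dots> = (\<Sum>i\<in>UNIV. \<Sum>j\<in>UNIV. if j = i then 2 *\<^sub>R t i i else 0)"
    unfolding sum.distrib[symmetric]
    by (intro sum.cong refl) (auto simp: scaleR_2 dest: anti)
  also have "\<dots> = 2 *\<^sub>R (\<Sum>i\<in>UNIV. t i i)" by (simp add: scaleR_sum_right)
  finally have "(\<Sum>i\<in>UNIV. \<Sum>j\<in>UNIV. t i j) = (\<Sum>i\<in>UNIV. t i i)" by simp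
  also have "\<dots> = (\<epsilon> * (norm v)\<^sup>2) *\<^sub>R cl_one"
    by (simp add: diag scaleR_sum_left[symmetric] norm_vec_def L2_set_def sum_nonneg sum_distrib_left mult.commute)
  finally show ?thesis using S by simp
qed
definition cl_invol :: "'m::{finite,linorder} cliff \<Rightarrow> 'm cliff" where
  "cl_invol x = (\<chi> A. (-1) ^ card A * x $ A)"

inductive_set pin_set :: "real \<Rightarrow> 'm::{finite,linorder} cliff set" for \<epsilon> where
  "cl_one \<in> pin_set \<epsilon>"
| "a \<in> pin_set \<epsilon> \<Longrightarrow> norm v = 1 \<Longrightarrow> cl_mult \<epsilon> a (cl_vec v) \<in> pin_set \<epsilon>"

text \<open>\<open>Pin\<^sup>+\<close> for \<open>\<epsilon> = 1\<close> and \<open>Pin\<^sup>-\<close> for \<open>\<epsilon> = -1\<close>.\<close>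

definition Pin :: "real \<Rightarrow> 'm::{finite,linorder} cliff monoid" where
  "Pin \<epsilon> = \<lparr>carrier = pin_set \<epsilon>, mult = cl_mult \<epsilon>, one = cl_one\<rparr>"

text \<open>The twisted adjoint action \<open>x \<mapsto> \<alpha>(a) x a\<^sup>-\<^sup>1\<close>; a unit vector acts by the reflection in the
  orthogonal hyperplane.\<close>

definition pin_cover :: "real \<Rightarrow> 'm cliff \<Rightarrow> real^'m::{finite,linorder}^'m::{finite,linorder}" where
  "pin_cover \<epsilon> a =
     (THE A. \<forall>x. cl_mult \<epsilon> (cl_invol a) (cl_vec x) = cl_mult \<epsilon> (cl_vec (A *v x)) a)"

definition clifford_module ::
  "real \<Rightarrow> ('m::{finite,linorder} cliff \<Rightarrow> complex^'s^'s) \<Rightarrow> bool" where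
  "clifford_module \<epsilon> \<rho> \<longleftrightarrow>
     linear \<rho> \<and> \<rho> cl_one = mat 1 \<and> (\<forall>a b. \<rho> (cl_mult \<epsilon> a b) = \<rho> a ** \<rho> b)"


section \<open>Pin structures\<close>

record ('p, 'a, 'm) pin_struct = "('p, 'a, real^('m set)) pbundle" +
  cover :: "'p \<Rightarrow> 'a \<times> ('m \<Rightarrow> ('a, 'm) tvec)"

definition pin_structure ::
  "real \<Rightarrow> ('a, 'm) rmfd \<Rightarrow> ('a, 'm) metric
     \<Rightarrow> ('p, 'a, 'm::{finite,linorder}) pin_struct \<Rightarrow> bool" where
  "pin_structure \<epsilon> M g P \<longleftrightarrow>
     principal_bundle M (Pin \<epsilon>) P \<and>
     double_covering (total_mfd M (Pin \<epsilon>) P) (total_mfd M orth_group (frame_bundle M g)) (cover P) \<and>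
     (\<forall>p\<in>total P. proj (frame_bundle M g) (cover P p) = proj P p) \<and>
     (\<forall>p\<in>total P. \<forall>s\<in>pin_set \<epsilon>.
        cover P (act P p s) = act (frame_bundle M g) (cover P p) (pin_cover \<epsilon> s))"

definition sheet_exchange :: "('p, 'a, 'm::{finite,linorder}) pin_struct \<Rightarrow> 'p \<Rightarrow> 'p" where
  "sheet_exchange P p = act P p (- cl_one)"

definition pin_lift ::
  "real \<Rightarrow> ('a, 'm) rmfd \<Rightarrow> ('p, 'a, 'm::{finite,linorder}) pin_struct
     \<Rightarrow> ('a \<Rightarrow> 'a) \<Rightarrow> ('p \<Rightarrow> 'p) \<Rightarrow> bool" where
  "pin_lift \<epsilon> M P \<phi> L \<longleftrightarrow>
     diffeomorphism (total_mfd M (Pin \<epsilon>) P) (total_mfd M (Pin \<epsilon>) P) L \<and>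
     (\<forall>p\<in>total P. \<forall>s\<in>pin_set \<epsilon>. L (act P p s) = act P (L p) s) \<and>
     (\<forall>p\<in>total P. cover P (L p) = frame_map M M \<phi> (cover P p))"

text \<open>The quotient of a pin structure on \<open>M\<close> by an involutive lift \<open>L\<close> of the differential of the
  deck transformation of a double covering \<open>f : M \<rightarrow> N\<close>. Its points are the orbits \<open>{p, L p}\<close>; the
  local sections are those induced by local sections over open sets on which \<open>f\<close> is injective; the
  map to frames uses the identification of the quotient of the frame bundle of \<open>M\<close> with that of \<open>N\<close>
  given by the differential of \<open>f\<close>.\<close>

definition orbit :: "('p \<Rightarrow> 'p) \<Rightarrow> 'p \<Rightarrow> 'p set" where
  "orbit L p = {p, L p}"

definition quotient_pin ::
  "('a, 'm) rmfd \<Rightarrow> ('b, 'm) rmfd \<Rightarrow> ('a \<Rightarrow> 'b) \<Rightarrow> ('p, 'a, 'm::finite) pin_struct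
     \<Rightarrow> ('p \<Rightarrow> 'p) \<Rightarrow> ('p set, 'b, 'm) pin_struct" where
  "quotient_pin M N f P L =
     \<lparr>total = orbit L ` total P,
      proj = (\<lambda>Q. f (proj P (SOME p. p \<in> Q))),
      act = (\<lambda>Q s. (\<lambda>p. act P p s) ` Q),
      lsecs = {(f ` W, \<lambda>y. orbit L (\<sigma> (inv_into W f y))) | U W \<sigma>.
                 (U, \<sigma>) \<in> lsecs P \<and> openin (mtop M) W \<and> W \<subseteq> U \<and> inj_on f W},
      cover = (\<lambda>Q. frame_map M N f (cover P (SOME p. p \<in> Q)))\<rparr>"


section \<open>Pinor bundles and their sections\<close>

text \<open>The element \<open>[p, v]\<close> of the associated bundle, i.e. the class of \<open>(p, v)\<close> under
  \<open>(p \<cdot> s, w) \<sim> (p, \<rho>(s) w)\<close>.\<close>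

type_synonym ('p, 's) pinor = "('p \<times> (complex^'s)) set"

definition pinor ::
  "real \<Rightarrow> ('m::{finite,linorder} cliff \<Rightarrow> complex^'s^'s) \<Rightarrow> ('p, 'a, 'm) pin_struct
     \<Rightarrow> 'p \<Rightarrow> complex^'s \<Rightarrow> ('p, 's) pinor" where
  "pinor \<epsilon> \<rho> P p v = {(q, w). \<exists>s\<in>pin_set \<epsilon>. q = act P p s \<and> v = \<rho> s *v w}"

definition pinor_fibre ::
  "real \<Rightarrow> ('m::{finite,linorder} cliff \<Rightarrow> complex^'s^'s) \<Rightarrow> ('p, 'a, 'm) pin_struct
     \<Rightarrow> 'a \<Rightarrow> ('p, 's) pinor set" where
  "pinor_fibre \<epsilon> \<rho> P x = {pinor \<epsilon> \<rho> P p v | p v. p \<in> total P \<and> proj P p = x}"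

definition pinor_add ::
  "real \<Rightarrow> ('m::{finite,linorder} cliff \<Rightarrow> complex^'s^'s) \<Rightarrow> ('p, 'a, 'm) pin_struct
     \<Rightarrow> ('p, 's) pinor \<Rightarrow> ('p, 's) pinor \<Rightarrow> ('p, 's) pinor" where
  "pinor_add \<epsilon> \<rho> P S T =
     (THE R. \<exists>p\<in>total P. \<exists>v w.
        S = pinor \<epsilon> \<rho> P p v \<and> T = pinor \<epsilon> \<rho> P p w \<and> R = pinor \<epsilon> \<rho> P p (v + w))"

definition pinor_scale ::
  "real \<Rightarrow> ('m::{finite,linorder} cliff \<Rightarrow> complex^'s^'s) \<Rightarrow> ('p, 'a, 'm) pin_struct
     \<Rightarrow> complex \<Rightarrow> ('p, 's) pinor \<Rightarrow> ('p, 's) pinor" where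
  "pinor_scale \<epsilon> \<rho> P z S =
     (THE R. \<exists>p\<in>total P. \<exists>v. S = pinor \<epsilon> \<rho> P p v \<and> R = pinor \<epsilon> \<rho> P p (z *s v))"

definition pinor_sections ::
  "real \<Rightarrow> ('m::{finite,linorder} cliff \<Rightarrow> complex^'s^'s) \<Rightarrow> ('a, 'm) rmfd
     \<Rightarrow> ('p, 'a, 'm) pin_struct \<Rightarrow> ('a \<Rightarrow> ('p, 's) pinor) set" where
  "pinor_sections \<epsilon> \<rho> M P =
     {s \<in> extensional (pts M).
        (\<forall>x\<in>pts M. s x \<in> pinor_fibre \<epsilon> \<rho> P x) \<and>
        (\<forall>(U, \<sigma>)\<in>lsecs P. smooth_fun_on M U (\<lambda>x. THE v. s x = pinor \<epsilon> \<rho> P (\<sigma> x) v))}"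

definition section_add ::
  "real \<Rightarrow> ('m::{finite,linorder} cliff \<Rightarrow> complex^'s^'s) \<Rightarrow> ('a, 'm) rmfd
     \<Rightarrow> ('p, 'a, 'm) pin_struct \<Rightarrow> ('a \<Rightarrow> ('p, 's) pinor) \<Rightarrow> ('a \<Rightarrow> ('p, 's) pinor)
     \<Rightarrow> 'a \<Rightarrow> ('p, 's) pinor" where
  "section_add \<epsilon> \<rho> M P s t = restrict (\<lambda>x. pinor_add \<epsilon> \<rho> P (s x) (t x)) (pts M)"

definition section_scale ::
  "real \<Rightarrow> ('m::{finite,linorder} cliff \<Rightarrow> complex^'s^'s) \<Rightarrow> ('a, 'm) rmfd
     \<Rightarrow> ('p, 'a, 'm) pin_struct \<Rightarrow> complex \<Rightarrow> ('a \<Rightarrow> ('p, 's) pinor) \<Rightarrow> 'a \<Rightarrow> ('p, 's) pinor" where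
  "section_scale \<epsilon> \<rho> M P z s = restrict (\<lambda>x. pinor_scale \<epsilon> \<rho> P z (s x)) (pts M)"

text \<open>The action \<open>[p, v] \<mapsto> [L p, v]\<close> of an equivariant map \<open>L\<close>.\<close>

definition pinor_lift :: "('p \<Rightarrow> 'p) \<Rightarrow> ('p, 's) pinor \<Rightarrow> ('p, 's) pinor" where
  "pinor_lift L S = (\<lambda>(p, v). (L p, v)) ` S"

definition complex_linear_iso ::
  "'u set \<Rightarrow> ('u \<Rightarrow> 'u \<Rightarrow> 'u) \<Rightarrow> (complex \<Rightarrow> 'u \<Rightarrow> 'u) \<Rightarrow>
   'w set \<Rightarrow> ('w \<Rightarrow> 'w \<Rightarrow> 'w) \<Rightarrow> (complex \<Rightarrow> 'w \<Rightarrow> 'w) \<Rightarrow> ('u \<Rightarrow> 'w) \<Rightarrow> bool" where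
  "complex_linear_iso V addV scaleV W addW scaleW \<Phi> \<longleftrightarrow>
     bij_betw \<Phi> V W \<and>
     (\<forall>s\<in>V. \<forall>t\<in>V. addV s t \<in> V \<and> \<Phi> (addV s t) = addW (\<Phi> s) (\<Phi> t)) \<and>
     (\<forall>z. \<forall>s\<in>V. scaleV z s \<in> V \<and> \<Phi> (scaleV z s) = scaleW z (\<Phi> s))"

text \<open>\<open>\<Phi>\<close> sends a section to the one it induces on the quotient of the pin structure by \<open>L\<close>:
  if \<open>s\<close> takes the value \<open>[p, v]\<close> over \<open>x\<close>, then \<open>\<Phi> s\<close> takes the value \<open>[[p], v]\<close> over \<open>f x\<close>.\<close>

definition induced_by_quotient ::
  "real \<Rightarrow> ('m::{finite,linorder} cliff \<Rightarrow> complex^'s^'s) \<Rightarrow> ('a, 'm) rmfd \<Rightarrow> ('b, 'm) rmfd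
     \<Rightarrow> ('a \<Rightarrow> 'b) \<Rightarrow> ('p, 'a, 'm) pin_struct \<Rightarrow> ('p \<Rightarrow> 'p) \<Rightarrow> ('a \<Rightarrow> ('p, 's) pinor) set
     \<Rightarrow> (('a \<Rightarrow> ('p, 's) pinor) \<Rightarrow> 'b \<Rightarrow> ('p set, 's) pinor) \<Rightarrow> bool" where
  "induced_by_quotient \<epsilon> \<rho> M N f P L V \<Phi> \<longleftrightarrow>
     (\<forall>s\<in>V. \<forall>p\<in>total P. \<forall>v. s (proj P p) = pinor \<epsilon> \<rho> P p v \<longrightarrow>
        \<Phi> s (f (proj P p)) = pinor \<epsilon> \<rho> (quotient_pin M N f P L) (orbit L p) v)"

end

(* Over a point x of the double cover a frame p identifies the pinors of P with C^(2^n), and its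
   orbit {p, L p} identifies the pinors of P/L over the image of x with the same space. A section
   s of S thus has a coordinate function on the total space of P, and s is L-invariant iff this
   function is invariant under L, i.e. iff it is the coordinate function of a section of the
   quotient. The local sections of P/L are those of P carried down by local inverses of the
   covering, so smoothness transfers in both directions by the chain rule. The second isomorphism
   is the first one for the lift composed with gamma, because gamma acts on pinors by -1. *)

theory Submission
  imports Defs
begin

section \<open>Calculus of smooth maps\<close>

text \<open>The quotient is handled through its orbits and its local sections, so that
  \<open>P\<close> and \<open>P/L\<close> can share one algebraic theory: a Pin action that is free
  and transitive on fibres. On orbits, freeness rests on \<tau> having no fixed point: the two
  elements of \<open>{p, L p}\<close> then lie over different points of the double cover, so over
  each of them an orbit has a single frame. The obstacle on the analytic side is that a local
  section of \<open>P\<close> may be defined over a set containing both points of a fibre of the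
  covering, whereas a local section of \<open>P/L\<close> comes from a set on which the covering is
  injective. Smoothness is therefore treated as a local property throughout and is transferred sheet
  by sheet. The calculus of \<open>Ck_on\<close> and \<open>smooth_on\<close> serves this purpose;
  its substantial result is the chain rule.\<close>

lemma Ck_on_subset: "Ck_on k S f \<Longrightarrow> T \<subseteq> S \<Longrightarrow> Ck_on k T f"
  by (induction k arbitrary: f) (auto intro: continuous_on_subset)

text \<open>Openness of \<open>S\<close> matters: the derivatives are full derivatives at a point,
  so they are determined by values on \<open>S\<close> only if \<open>S\<close> is a
  neighbourhood.\<close>

lemma Ck_on_cong:
  assumes "open S" "\<And>x. x \<in> S \<Longrightarrow> f x = g x" "Ck_on k S f"
  shows "Ck_on k S g"
  using assms(2,3)
proof (induction k arbitrary: f g)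
  case 0
  then show ?case by (auto cong: continuous_on_cong)
next
  case (Suc k)
  have d: "f differentiable at x" if "x \<in> S" for x
    using Suc.prems that by simp
  have "(g has_derivative frechet_derivative f (at x)) (at x)" if "x \<in> S" for x
    by (rule has_derivative_transform_within_open[of f, OF _ assms(1) that])
      (use d[OF that] Suc.prems(1) in \<open>auto simp: frechet_derivative_works\<close>)
  then have "g differentiable at x" "frechet_derivative f (at x) = frechet_derivative g (at x)" if "x \<in> S" for x
    using that by (auto simp: differentiable_def intro: frechet_derivative_at)
  then have "Ck_on k S (\<lambda>x. frechet_derivative g (at x) v)" "\<forall>x\<in>S. g differentiable at x" for v
    using Suc.IH[of "\<lambda>x. frechet_derivative f (at x) v"] Suc.prems(2) by simp_all
  then show ?case by simp
qed

lemma Ck_on_SucD: "Ck_on (Suc k) S f \<Longrightarrow> Ck_on k S f"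
proof (induction k arbitrary: f)
  case 0
  then show ?case
    by (auto intro!: continuous_at_imp_continuous_on differentiable_imp_continuous_within)
next
  case (Suc k)
  show ?case
    unfolding Ck_on.simps(2)[of k]
  proof (intro conjI allI)
    show "\<forall>x\<in>S. f differentiable at x" using Suc.prems unfolding Ck_on.simps(2)[of "Suc k"] by blast
    fix v
    have "Ck_on (Suc k) S (\<lambda>x. frechet_derivative f (at x) v)"
      using Suc.prems unfolding Ck_on.simps(2)[of "Suc k"] by blast
    then show "Ck_on k S (\<lambda>x. frechet_derivative f (at x) v)" by (rule Suc.IH)
  qed
qed

text \<open>Allows the inductions that follow to work with a derivative given by a formula in place
  of the chosen \<open>frechet_derivative\<close>.\<close>

lemma Ck_on_Suc_derivative:
  assumes "open S" "\<And>x. x \<in> S \<Longrightarrow> (f has_derivative f' x) (at x)" "\<And>v. Ck_on k S (\<lambda>x. f' x v)"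
  shows "Ck_on (Suc k) S f"
proof -
  have "frechet_derivative f (at x) = f' x" if "x \<in> S" for x
    using frechet_derivative_at[OF assms(2)[OF that]] by simp
  then have "Ck_on k S (\<lambda>x. frechet_derivative f (at x) v)" for v
    by (intro Ck_on_cong[OF assms(1) _ assms(3)[of v]]) simp
  moreover have "\<forall>x\<in>S. f differentiable at x"
    using assms(2) unfolding differentiable_def by blast
  ultimately show ?thesis by simp
qed

lemma Ck_on_has_derivative:
  "Ck_on (Suc k) S f \<Longrightarrow> x \<in> S \<Longrightarrow> (f has_derivative frechet_derivative f (at x)) (at x)"
  by (auto simp: frechet_derivative_works)

lemma Ck_on_const: "open S \<Longrightarrow> Ck_on k S (\<lambda>x. c)"
  by (induction k arbitrary: c) (auto simp: frechet_derivative_const)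

lemma Ck_on_add:
  assumes "open S" "Ck_on k S f" "Ck_on k S g"
  shows "Ck_on k S (\<lambda>x. f x + g x)"
  using assms(2,3)
proof (induction k arbitrary: f g)
  case (Suc k)
  then show ?case
    by (intro Ck_on_Suc_derivative[OF assms(1) has_derivative_add[OF
          Ck_on_has_derivative[OF Suc.prems(1)] Ck_on_has_derivative[OF Suc.prems(2)]]]) auto
qed (auto intro: continuous_intros)

lemma Ck_on_sum:
  assumes "open S" "\<And>i. i \<in> I \<Longrightarrow> Ck_on k S (f i)"
  shows "Ck_on k S (\<lambda>x. \<Sum>i\<in>I. f i x)"
  using assms(2) by (induction I rule: infinite_finite_induct) (auto intro: Ck_on_const Ck_on_add assms(1))

lemma Ck_on_linear:
  assumes "open S" "bounded_linear h" "Ck_on k S f"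
  shows "Ck_on k S (\<lambda>x. h (f x))"
  using assms(3)
proof (induction k arbitrary: f)
  case (Suc k)
  then show ?case
    by (intro Ck_on_Suc_derivative[OF assms(1) bounded_linear.has_derivative[OF assms(2)
          Ck_on_has_derivative[OF Suc.prems]]]) auto
qed (auto intro: bounded_linear.continuous_on[OF assms(2)])

text \<open>In each summand of the product rule one factor stays undifferentiated and is C^(k+1);
  \<open>Ck_on_SucD\<close> lowers it to C^k so that the induction hypothesis applies.\<close>

lemma Ck_on_bilinear:
  assumes "open S" "bounded_bilinear h" "Ck_on k S f" "Ck_on k S g"
  shows "Ck_on k S (\<lambda>x. h (f x) (g x))"
  using assms(3,4)
proof (induction k arbitrary: f g)
  case (Suc k)
  then show ?case
    by (intro Ck_on_Suc_derivative[OF assms(1) bounded_bilinear.FDERIV[OF assms(2)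
          Ck_on_has_derivative[OF Suc.prems(1)] Ck_on_has_derivative[OF Suc.prems(2)]]]
        Ck_on_add[OF assms(1)] Suc.IH Ck_on_SucD[OF Suc.prems(1)] Ck_on_SucD[OF Suc.prems(2)]) auto
qed (auto intro: bounded_bilinear.continuous_on[OF assms(2)])

text \<open>The derivative of the composite is \<open>g'\<close> at \<open>f x\<close> applied to a
  direction that itself varies with \<open>x\<close>, while \<open>Ck_on\<close> speaks of fixed
  directions. Expanding that direction in \<open>Basis\<close> turns the derivative into a sum of
  scalar functions times \<open>?g' (f x) b\<close> with \<open>b\<close> fixed, to which the
  product rule and the induction hypothesis apply. Hence the Euclidean type in the middle.\<close>

lemma Ck_on_compose:
  fixes f :: "'a::real_normed_vector \<Rightarrow> 'b::euclidean_space"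
  assumes "open S" "f ` S \<subseteq> T" "Ck_on k S f" "Ck_on k T g"
  shows "Ck_on k S (\<lambda>x. g (f x))"
  using assms(3,4)
proof (induction k arbitrary: g)
  case 0
  then show ?case using assms(2) by (auto intro: continuous_on_compose2)
next
  case (Suc k)
  let ?f' = "\<lambda>x. frechet_derivative f (at x)" and ?g' = "\<lambda>y. frechet_derivative g (at y)"
  have g': "(g has_derivative ?g' (f x)) (at (f x))" if "x \<in> S" for x
    using that assms(2) by (intro Ck_on_has_derivative[OF Suc.prems(2)]) auto
  show ?case
  proof (rule Ck_on_Suc_derivative[OF assms(1)])
    fix x assume x: "x \<in> S"
    show "((\<lambda>x. g (f x)) has_derivative (\<lambda>v. ?g' (f x) (?f' x v))) (at x)"
      using diff_chain_at[OF Ck_on_has_derivative[OF Suc.prems(1) x] g'[OF x]] by (simp add: o_def)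
  next
    fix v
    have "Ck_on k S (\<lambda>x. ?f' x v \<bullet> b)" for b
      using Suc.prems(1) by (intro Ck_on_linear[OF assms(1) bounded_linear_inner_left]) simp
    moreover have "Ck_on k S (\<lambda>x. ?g' (f x) b)" for b
      by (rule Suc.IH[OF Ck_on_SucD[OF Suc.prems(1)]]) (use Suc.prems(2) in simp)
    ultimately have sum: "Ck_on k S (\<lambda>x. \<Sum>b\<in>Basis. (?f' x v \<bullet> b) *\<^sub>R ?g' (f x) b)"
      by (intro Ck_on_sum[OF assms(1)] Ck_on_bilinear[OF assms(1) bounded_bilinear_scaleR])
    have eq: "(\<Sum>b\<in>Basis. (?f' x v \<bullet> b) *\<^sub>R ?g' (f x) b) = ?g' (f x) (?f' x v)" if "x \<in> S" for x
    proof -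
      interpret linear "?g' (f x)" using g'[OF that] by (rule has_derivative_linear)
      have "?g' (f x) (\<Sum>b\<in>Basis. (?f' x v \<bullet> b) *\<^sub>R b) = (\<Sum>b\<in>Basis. (?f' x v \<bullet> b) *\<^sub>R ?g' (f x) b)"
        by (simp add: sum scale)
      then show ?thesis by (simp add: euclidean_representation)
    qed
    show "Ck_on k S (\<lambda>x. ?g' (f x) (?f' x v))"
      by (rule Ck_on_cong[OF assms(1) eq sum])
  qed
qed

section \<open>Smoothness on arbitrary subsets through local extensions\<close>

lemma smooth_onE:
  assumes "smooth_on S f" "x \<in> S"
  obtains W h where "open W" "x \<in> W" "\<And>k. Ck_on k W h" "\<And>y. y \<in> W \<Longrightarrow> y \<in> S \<Longrightarrow> h y = f y"
proof -
  from bspec[OF assms(1)[unfolded smooth_on_def] assms(2)] obtain W h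
    where W: "open W" "x \<in> W" "\<forall>k. Ck_on k W h" "\<forall>y\<in>W \<inter> S. h y = f y"
    by blast
  show ?thesis by (rule that[of W h]) (simp_all add: W)
qed

lemma smooth_on_witness:
  assumes "open W" "x \<in> W" "\<And>k. Ck_on k W h" "\<And>y. y \<in> W \<Longrightarrow> y \<in> S \<Longrightarrow> h y = f y"
  shows "\<exists>W h. open W \<and> x \<in> W \<and> (\<forall>k. Ck_on k W h) \<and> (\<forall>y\<in>W \<inter> S. h y = f y)"
  using assms by (intro exI[of _ W] exI[of _ h]) simp

lemma smooth_on_subset:
  assumes "smooth_on S f" "T \<subseteq> S"
  shows "smooth_on T f"
  unfolding smooth_on_def
proof
  fix x assume "x \<in> T"
  with assms(2) have "x \<in> S" by blast
  with assms(1) obtain W h where "open W" "x \<in> W" "\<And>k. Ck_on k W h" "\<And>y. y \<in> W \<Longrightarrow> y \<in> S \<Longrightarrow> h y = f y"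
    by (rule smooth_onE) blast
  then show "\<exists>W h. open W \<and> x \<in> W \<and> (\<forall>k. Ck_on k W h) \<and> (\<forall>y\<in>W \<inter> T. h y = f y)"
    by (rule smooth_on_witness) (use assms(2) in auto)
qed

lemma smooth_on_cong: "smooth_on S f \<Longrightarrow> (\<And>x. x \<in> S \<Longrightarrow> f x = g x) \<Longrightarrow> smooth_on S g"
  unfolding smooth_on_def by simp

lemma smooth_on_local:
  assumes "\<And>x. x \<in> S \<Longrightarrow> \<exists>W. open W \<and> x \<in> W \<and> smooth_on (S \<inter> W) f"
  shows "smooth_on S f"
  unfolding smooth_on_def
proof
  fix x assume x: "x \<in> S"
  then obtain W where W: "open W" "x \<in> W" and f: "smooth_on (S \<inter> W) f" using assms by blast
  from x W have "x \<in> S \<inter> W" by simp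
  with f obtain W' h where W': "open W'" "x \<in> W'" "\<And>k. Ck_on k W' h"
    "\<And>y. y \<in> W' \<Longrightarrow> y \<in> S \<inter> W \<Longrightarrow> h y = f y"
    by (rule smooth_onE) blast
  show "\<exists>W h. open W \<and> x \<in> W \<and> (\<forall>k. Ck_on k W h) \<and> (\<forall>y\<in>W \<inter> S. h y = f y)"
    by (rule smooth_on_witness[of "W' \<inter> W" _ h]) (use W W' in \<open>auto intro: Ck_on_subset[OF W'(3)]\<close>)
qed

lemma smooth_on_add:
  assumes "smooth_on S f" "smooth_on S g"
  shows "smooth_on S (\<lambda>x. f x + g x)"
  unfolding smooth_on_def
proof
  fix x assume x: "x \<in> S"
  from assms(1) x obtain W h where W: "open W" "x \<in> W" "\<And>k. Ck_on k W h"
    "\<And>y. y \<in> W \<Longrightarrow> y \<in> S \<Longrightarrow> h y = f y"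
    by (rule smooth_onE) blast
  from assms(2) x obtain W' h' where W': "open W'" "x \<in> W'" "\<And>k. Ck_on k W' h'"
    "\<And>y. y \<in> W' \<Longrightarrow> y \<in> S \<Longrightarrow> h' y = g y"
    by (rule smooth_onE) blast
  have "open (W \<inter> W')" using W W' by blast
  then have "Ck_on k (W \<inter> W') (\<lambda>x. h x + h' x)" for k
    by (rule Ck_on_add[OF _ Ck_on_subset[OF W(3)] Ck_on_subset[OF W'(3)]]) auto
  with W W' show "\<exists>W h. open W \<and> x \<in> W \<and> (\<forall>k. Ck_on k W h) \<and> (\<forall>y\<in>W \<inter> S. h y = f y + g y)"
    by (intro smooth_on_witness[of "W \<inter> W'" _ "\<lambda>x. h x + h' x"]) auto
qed

lemma smooth_on_linear:
  assumes "smooth_on S f" "bounded_linear h"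
  shows "smooth_on S (\<lambda>x. h (f x))"
  unfolding smooth_on_def
proof
  fix x assume x: "x \<in> S"
  with assms(1) obtain W f' where W: "open W" "x \<in> W" "\<And>k. Ck_on k W f'"
    "\<And>y. y \<in> W \<Longrightarrow> y \<in> S \<Longrightarrow> f' y = f y"
    by (rule smooth_onE) blast
  show "\<exists>W g. open W \<and> x \<in> W \<and> (\<forall>k. Ck_on k W g) \<and> (\<forall>y\<in>W \<inter> S. g y = h (f y))"
    by (rule smooth_on_witness[OF W(1,2) Ck_on_linear[OF W(1) assms(2) W(3)]]) (simp add: W(4))
qed

text \<open>Away from \<open>S\<close> the extension of \<open>f\<close> may leave \<open>T\<close>;
  it only has to land in the open domain of the extension of \<open>g\<close>. The neighbourhood is
  cut down to the corresponding preimage, which is open because the extension is C^0.\<close>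

lemma smooth_on_compose:
  fixes f :: "'a::real_normed_vector \<Rightarrow> 'b::euclidean_space"
  assumes "smooth_on S f" "smooth_on T g" "f ` S \<subseteq> T"
  shows "smooth_on S (\<lambda>x. g (f x))"
  unfolding smooth_on_def
proof
  fix x assume x: "x \<in> S"
  with assms(1) obtain W f' where W: "open W" "x \<in> W" "\<And>k. Ck_on k W f'"
    "\<And>y. y \<in> W \<Longrightarrow> y \<in> S \<Longrightarrow> f' y = f y"
    by (rule smooth_onE) blast
  have "f x \<in> T" using assms(3) x by blast
  with assms(2) obtain W' g' where W': "open W'" "f x \<in> W'" "\<And>k. Ck_on k W' g'"
    "\<And>y. y \<in> W' \<Longrightarrow> y \<in> T \<Longrightarrow> g' y = g y"
    by (rule smooth_onE) blast
  have op: "open (W \<inter> f' -` W')"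
    using W(3)[of 0] W(1) W'(1) by (auto intro: continuous_open_preimage)
  show "\<exists>W h. open W \<and> x \<in> W \<and> (\<forall>k. Ck_on k W h) \<and> (\<forall>y\<in>W \<inter> S. h y = g (f y))"
  proof (rule smooth_on_witness[OF op])
    show "Ck_on k (W \<inter> f' -` W') (\<lambda>x. g' (f' x))" for k
      by (rule Ck_on_compose[OF op _ Ck_on_subset[OF W(3)] W'(3)]) auto
    show "g' (f' y) = g (f y)" if "y \<in> W \<inter> f' -` W'" "y \<in> S" for y
      using that assms(3) W(4)[of y] by (auto intro!: W'(4))
  qed (use W(2,4) W'(2) x in auto)
qed

section \<open>Smooth functions on manifolds\<close>

lemma smooth_manifold_chartD:
  assumes "smooth_manifold M" "c \<in> charts M"
  shows "openin (mtop M) (fst c)" "open (snd c ` fst c)" "inj_on (snd c) (fst c)"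
    "homeomorphic_map (subtopology (mtop M) (fst c)) (top_of_set (snd c ` fst c)) (snd c)"
proof -
  show h: "homeomorphic_map (subtopology (mtop M) (fst c)) (top_of_set (snd c ` fst c)) (snd c)"
    and "open (snd c ` fst c)" and o: "openin (mtop M) (fst c)"
    using assms unfolding smooth_manifold_def by auto
  show "inj_on (snd c) (fst c)"
    using homeomorphic_imp_injective_map[OF h] openin_subset[OF o] by (simp add: Int_absorb1)
qed

lemma smooth_manifold_chart_at:
  assumes "smooth_manifold M" "x \<in> pts M"
  obtains c where "c \<in> charts M" "x \<in> fst c"
  using assms unfolding smooth_manifold_def by blast

lemma open_chart_image:
  assumes "smooth_manifold M" "c \<in> charts M" "openin (mtop M) U"
  shows "open (snd c ` (fst c \<inter> U))"
proof -
  note c = smooth_manifold_chartD[OF assms(1,2)]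
  have "openin (subtopology (mtop M) (fst c)) (fst c \<inter> U)"
    using assms(3) by (auto simp: openin_subtopology)
  with homeomorphic_imp_open_map[OF c(4)] have "openin (top_of_set (snd c ` fst c)) (snd c ` (fst c \<inter> U))"
    by (auto simp: open_map_def)
  with c(2) show ?thesis by (simp add: openin_open_eq)
qed

lemma smooth_fun_on_subset: "smooth_fun_on M U f \<Longrightarrow> V \<subseteq> U \<Longrightarrow> smooth_fun_on M V f"
  unfolding smooth_fun_on_def by (meson image_mono Int_mono order_refl smooth_on_subset)

lemma smooth_fun_on_cong:
  assumes "smooth_fun_on M U f" "\<And>x. x \<in> U \<Longrightarrow> f x = g x" "smooth_manifold M"
  shows "smooth_fun_on M U g"
  unfolding smooth_fun_on_def
proof
  fix c assume c: "c \<in> charts M"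
  then have "smooth_on (snd c ` (fst c \<inter> U)) (f \<circ> chart_inv c)"
    using assms(1) by (auto simp: smooth_fun_on_def)
  then show "smooth_on (snd c ` (fst c \<inter> U)) (g \<circ> chart_inv c)"
    by (rule smooth_on_cong) (auto simp: assms(2) smooth_manifold_chartD(3)[OF assms(3) c])
qed

lemma smooth_fun_on_local:
  assumes M: "smooth_manifold M"
    and "\<And>x. x \<in> U \<Longrightarrow> \<exists>V. openin (mtop M) V \<and> x \<in> V \<and> smooth_fun_on M (U \<inter> V) f"
  shows "smooth_fun_on M U f"
  unfolding smooth_fun_on_def
proof
  fix c assume c: "c \<in> charts M"
  show "smooth_on (snd c ` (fst c \<inter> U)) (f \<circ> chart_inv c)"
  proof (rule smooth_on_local)
    fix z assume "z \<in> snd c ` (fst c \<inter> U)"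
    then obtain x where x: "z = snd c x" "x \<in> fst c" "x \<in> U" by auto
    with assms(2) obtain V where V: "openin (mtop M) V" "x \<in> V" "smooth_fun_on M (U \<inter> V) f" by blast
    have "smooth_on (snd c ` (fst c \<inter> (U \<inter> V))) (f \<circ> chart_inv c)"
      using V(3) c by (auto simp: smooth_fun_on_def)
    moreover have "snd c ` (fst c \<inter> U) \<inter> snd c ` (fst c \<inter> V) = snd c ` (fst c \<inter> (U \<inter> V))"
      using smooth_manifold_chartD(3)[OF M c] by (auto simp: inj_on_def)
    ultimately show "\<exists>W. open W \<and> z \<in> W \<and> smooth_on (snd c ` (fst c \<inter> U) \<inter> W) (f \<circ> chart_inv c)"
      using open_chart_image[OF M c V(1)] x V(2) by (intro exI[of _ "snd c ` (fst c \<inter> V)"]) auto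
  qed
qed

lemma smooth_fun_on_add:
  "smooth_fun_on M U f \<Longrightarrow> smooth_fun_on M U g \<Longrightarrow> smooth_fun_on M U (\<lambda>x. f x + g x)"
  unfolding smooth_fun_on_def o_def by (simp add: smooth_on_add)

lemma smooth_fun_on_linear:
  "smooth_fun_on M U f \<Longrightarrow> bounded_linear h \<Longrightarrow> smooth_fun_on M U (\<lambda>x. h (f x))"
  unfolding smooth_fun_on_def o_def by (simp add: smooth_on_linear[where h = h])

text \<open>Near each point the values of \<phi> lie in one chart domain of \<open>N\<close>. There
  the coordinate expression factors as \<open>f \<circ> chart_inv d\<close> after
  \<open>snd d \<circ> \<phi> \<circ> chart_inv c\<close>, both smooth on subsets of coordinate
  space.\<close>

lemma smooth_fun_on_compose:
  fixes M :: "('a, real^'m) mfd" and N :: "('b, real^'k) mfd"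
  assumes M: "smooth_manifold M" and N: "smooth_manifold N"
    and \<phi>: "smooth_map M N \<phi>" and f: "smooth_fun_on N T f" and ST: "\<phi> ` S \<subseteq> T" "S \<subseteq> pts M"
  shows "smooth_fun_on M S (\<lambda>x. f (\<phi> x))"
proof (rule smooth_fun_on_local[OF M])
  fix x assume x: "x \<in> S"
  have cont: "continuous_map (mtop M) (mtop N) \<phi>" using \<phi> by (simp add: smooth_map_def)
  have "\<phi> x \<in> pts N" using cont x ST by (auto simp: continuous_map_def)
  then obtain d where d: "d \<in> charts N" "\<phi> x \<in> fst d" by (rule smooth_manifold_chart_at[OF N])
  let ?V = "{x \<in> pts M. \<phi> x \<in> fst d}"
  have "openin (mtop M) ?V"
    using cont smooth_manifold_chartD(1)[OF N d(1)] by (auto simp: continuous_map_def)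
  moreover have "smooth_fun_on M (S \<inter> ?V) (\<lambda>x. f (\<phi> x))"
    unfolding smooth_fun_on_def
  proof
    fix c assume c: "c \<in> charts M"
    note inj = smooth_manifold_chartD(3)[OF M c] smooth_manifold_chartD(3)[OF N d(1)]
    have "smooth_on (snd c ` (fst c \<inter> (S \<inter> ?V))) (\<lambda>z. (f \<circ> chart_inv d) ((snd d \<circ> \<phi> \<circ> chart_inv c) z))"
    proof (rule smooth_on_compose)
      show "smooth_on (snd c ` (fst c \<inter> (S \<inter> ?V))) (snd d \<circ> \<phi> \<circ> chart_inv c)"
        using \<phi> c d by (auto simp: smooth_map_def intro: smooth_on_subset)
      show "smooth_on (snd d ` (fst d \<inter> T)) (f \<circ> chart_inv d)"
        using f d by (auto simp: smooth_fun_on_def)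
      show "(snd d \<circ> \<phi> \<circ> chart_inv c) ` snd c ` (fst c \<inter> (S \<inter> ?V)) \<subseteq> snd d ` (fst d \<inter> T)"
        using ST(1) inj by auto
    qed
    then show "smooth_on (snd c ` (fst c \<inter> (S \<inter> ?V))) ((\<lambda>x. f (\<phi> x)) \<circ> chart_inv c)"
      by (rule smooth_on_cong) (use inj in auto)
  qed
  ultimately show "\<exists>V. openin (mtop M) V \<and> x \<in> V \<and> smooth_fun_on M (S \<inter> V) (\<lambda>x. f (\<phi> x))"
    using x d ST by blast
qed

text \<open>Shrinking a chart changes the term \<open>chart_inv c\<close>, since
  \<open>inv_into\<close> depends on the domain; injectivity makes the old and the new inverse agree
  where both are used.\<close>

lemma inv_into_subset_eq:
  "inj_on f A \<Longrightarrow> B \<subseteq> A \<Longrightarrow> y \<in> f ` B \<Longrightarrow> inv_into B f y = inv_into A f y"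
  by (auto simp: inj_on_subset subset_iff)

lemma pts_open_submfd: "openin (mtop M) U \<Longrightarrow> pts (open_submfd M U) = U"
  by (auto simp: open_submfd_def dest: openin_subset)

lemma smooth_manifold_open_submfd:
  assumes M: "smooth_manifold M" and U: "openin (mtop M) U"
  shows "smooth_manifold (open_submfd M U)"
proof -
  have "homeomorphic_map (subtopology (subtopology (mtop M) U) (fst c \<inter> U))
      (top_of_set (snd c ` (fst c \<inter> U))) (snd c)" if "c \<in> charts M" for c
  proof -
    note c = smooth_manifold_chartD[OF M that]
    have "homeomorphic_map (subtopology (subtopology (mtop M) (fst c)) (fst c \<inter> U))
       (subtopology (top_of_set (snd c ` fst c)) (snd c ` (fst c \<inter> U))) (snd c)"
      using c(1) by (intro homeomorphic_map_subtopologies[OF c(4)]) (use U in \<open>auto dest: openin_subset\<close>)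
    moreover have "fst c \<inter> (fst c \<inter> U) = U \<inter> (fst c \<inter> U)"
      "snd c ` fst c \<inter> snd c ` (fst c \<inter> U) = snd c ` (fst c \<inter> U)" by auto
    ultimately show ?thesis by (simp only: subtopology_subtopology)
  qed
  moreover have "openin (subtopology (mtop M) U) (fst c \<inter> U)" "open (snd c ` (fst c \<inter> U))"
    if "c \<in> charts M" for c
    using smooth_manifold_chartD[OF M that] U open_chart_image[OF M that U]
    by (auto intro!: openin_subtopology_Int)
  moreover have "smooth_on (snd c ` (fst c \<inter> U \<inter> (fst d \<inter> U))) (snd d \<circ> inv_into (fst c \<inter> U) (snd c))"
    if "c \<in> charts M" "d \<in> charts M" for c d
  proof -
    have "smooth_on (snd c ` (fst c \<inter> fst d)) (snd d \<circ> chart_inv c)"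
      using M that by (auto simp: smooth_manifold_def)
    then have "smooth_on (snd c ` (fst c \<inter> U \<inter> (fst d \<inter> U))) (snd d \<circ> chart_inv c)"
      by (rule smooth_on_subset) auto
    then show ?thesis
      by (rule smooth_on_cong)
        (use smooth_manifold_chartD(3)[OF M that(1)] in \<open>auto simp: inv_into_subset_eq inj_on_subset\<close>)
  qed
  moreover have "(\<Union>c\<in>charts M. fst c \<inter> U) = pts M \<inter> U"
    using M unfolding smooth_manifold_def by blast
  ultimately show ?thesis
    using M unfolding smooth_manifold_def open_submfd_def
    by (simp add: Hausdorff_space_subtopology second_countable_subtopology)
qed

text \<open>The sheets of a double covering are diffeomorphic as open submanifolds, whereas sections
  are tested on the whole manifold; this passes between the two.\<close>

lemma smooth_fun_on_open_submfd_iff: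
  assumes M: "smooth_manifold M" and SU: "S \<subseteq> U"
  shows "smooth_fun_on (open_submfd M U) S f \<longleftrightarrow> smooth_fun_on M S f"
proof -
  have "smooth_on (snd c ` (fst c \<inter> U \<inter> S)) (f \<circ> inv_into (fst c \<inter> U) (snd c)) \<longleftrightarrow>
    smooth_on (snd c ` (fst c \<inter> S)) (f \<circ> chart_inv c)" if "c \<in> charts M" for c
  proof -
    have "fst c \<inter> U \<inter> S = fst c \<inter> S" using SU by auto
    moreover have "inv_into (fst c \<inter> U) (snd c) z = chart_inv c z" if "z \<in> snd c ` (fst c \<inter> S)" for z
      using smooth_manifold_chartD(3)[OF M \<open>c \<in> _\<close>] SU that by (intro inv_into_subset_eq) auto
    ultimately show ?thesis by (auto intro: smooth_on_cong)
  qed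
  then show ?thesis unfolding smooth_fun_on_def open_submfd_def by simp
qed

section \<open>Sheets and fibres of double coverings\<close>

lemma double_coveringE:
  assumes "double_covering M N f" "y \<in> pts N"
  obtains V U1 U2 where "openin (mtop N) V" "y \<in> V" "openin (mtop M) U1" "openin (mtop M) U2"
    "U1 \<inter> U2 = {}" "{x \<in> pts M. f x \<in> V} = U1 \<union> U2"
    "diffeomorphism (open_submfd M U1) (open_submfd N V) f"
    "diffeomorphism (open_submfd M U2) (open_submfd N V) f"
proof -
  have "\<forall>y\<in>pts N. \<exists>V U1 U2. openin (mtop N) V \<and> y \<in> V \<and>
      openin (mtop M) U1 \<and> openin (mtop M) U2 \<and> U1 \<inter> U2 = {} \<and> {x \<in> pts M. f x \<in> V} = U1 \<union> U2 \<and>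
      diffeomorphism (open_submfd M U1) (open_submfd N V) f \<and>
      diffeomorphism (open_submfd M U2) (open_submfd N V) f"
    using assms(1) unfolding double_covering_def by (rule conjunct2)
  from bspec[OF this assms(2)] show ?thesis
    by (elim exE conjE) (rule that)
qed

lemma double_covering_sheet:
  assumes f: "double_covering M N f" and x: "x \<in> pts M"
  obtains U V where "openin (mtop M) U" "x \<in> U" "openin (mtop N) V"
    "diffeomorphism (open_submfd M U) (open_submfd N V) f"
proof -
  have "f x \<in> pts N" using f x by (auto simp: double_covering_def smooth_map_def continuous_map_def)
  with f obtain V U1 U2 where V: "openin (mtop N) V" "f x \<in> V" "openin (mtop M) U1" "openin (mtop M) U2"
    "U1 \<inter> U2 = {}" "{x \<in> pts M. f x \<in> V} = U1 \<union> U2"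
    "diffeomorphism (open_submfd M U1) (open_submfd N V) f"
    "diffeomorphism (open_submfd M U2) (open_submfd N V) f"
    by (rule double_coveringE)
  with x have "x \<in> U1 \<or> x \<in> U2" by blast
  then show ?thesis
  proof
    assume "x \<in> U1"
    then show ?thesis by (rule that[OF V(3) _ V(1) V(7)])
  next
    assume "x \<in> U2"
    then show ?thesis by (rule that[OF V(4) _ V(1) V(8)])
  qed
qed

text \<open>Each of the two disjoint sheets over an evenly covered neighbourhood of \<open>y\<close>
  maps bijectively onto it, so each contributes one preimage.\<close>

lemma double_covering_fibre:
  assumes f: "double_covering M N f" and y: "y \<in> pts N"
  obtains x x' where "x \<noteq> x'" "{z \<in> pts M. f z = y} = {x, x'}"
proof -
  from f y obtain V U1 U2 where V: "openin (mtop N) V" "y \<in> V" "openin (mtop M) U1" "openin (mtop M) U2"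
    "U1 \<inter> U2 = {}" "{x \<in> pts M. f x \<in> V} = U1 \<union> U2"
    and d: "diffeomorphism (open_submfd M U1) (open_submfd N V) f"
    "diffeomorphism (open_submfd M U2) (open_submfd N V) f"
    by (rule double_coveringE)
  from d V(1,3,4) have b: "bij_betw f U1 V" "bij_betw f U2 V"
    by (simp_all add: diffeomorphism_def pts_open_submfd)
  with V(2) have "y \<in> f ` U1" "y \<in> f ` U2" by (simp_all add: bij_betw_def)
  then obtain x x' where x: "x \<in> U1" "f x = y" "x' \<in> U2" "f x' = y" by (metis imageE)
  have "{z \<in> pts M. f z = y} = {x, x'}"
  proof (intro equalityI subsetI)
    fix z assume "z \<in> {z \<in> pts M. f z = y}"
    with V have "z \<in> U1 \<or> z \<in> U2" "f z = y" by auto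
    with b x show "z \<in> {x, x'}" by (auto simp: bij_betw_def inj_on_def)
  next
    fix z assume "z \<in> {x, x'}"
    with x V openin_subset show "z \<in> {z \<in> pts M. f z = y}" by blast
  qed
  moreover have "x \<noteq> x'" using x V by auto
  ultimately show ?thesis using that by blast
qed

lemma double_covering_push_smooth_fun:
  fixes M :: "('a, real^'m) mfd" and N :: "('b, real^'k) mfd"
  assumes M: "smooth_manifold M" and N: "smooth_manifold N" and f: "double_covering M N f"
    and W: "openin (mtop M) W" "inj_on f W" and v: "smooth_fun_on M W v"
  shows "smooth_fun_on N (f ` W) (\<lambda>y. v (inv_into W f y))"
proof (rule smooth_fun_on_local[OF N])
  fix y assume "y \<in> f ` W"
  then obtain x where x: "x \<in> W" "y = f x" by auto
  with W(1) have "x \<in> pts M" by (auto dest: openin_subset)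
  with f obtain U V where U: "openin (mtop M) U" "x \<in> U" and V: "openin (mtop N) V"
    and d: "diffeomorphism (open_submfd M U) (open_submfd N V) f"
    by (rule double_covering_sheet)
  have b: "bij_betw f U V" and s: "smooth_map (open_submfd N V) (open_submfd M U) (inv_into U f)"
    using d U V by (simp_all add: diffeomorphism_def pts_open_submfd)
  have inv: "inv_into U f (f z) = z" if "z \<in> U" for z
    using b that by (simp add: bij_betw_def)
  \<comment> \<open>This image is the preimage of \<open>W \<inter> U\<close> under the continuous
    inverse on the sheet, hence open in \<open>V\<close> and so in \<open>N\<close>.\<close>
  have "openin (mtop N) (f ` (W \<inter> U))"
  proof -
    have "continuous_map (subtopology (mtop N) V) (subtopology (mtop M) U) (inv_into U f)"
      using s by (simp add: smooth_map_def open_submfd_def)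
    then have "openin (subtopology (mtop N) V) {y \<in> topspace (subtopology (mtop N) V). inv_into U f y \<in> W \<inter> U}"
      using W(1) by (intro openin_continuous_map_preimage) (auto intro: openin_subtopology_Int)
    moreover have "{y \<in> topspace (subtopology (mtop N) V). inv_into U f y \<in> W \<inter> U} = f ` (W \<inter> U)"
    proof -
      have "topspace (subtopology (mtop N) V) = f ` U"
        using b openin_subset[OF V] by (auto simp: bij_betw_def)
      then show ?thesis using inv by auto
    qed
    ultimately show ?thesis using V by (simp add: openin_open_subtopology)
  qed
  moreover have "smooth_fun_on N (f ` (W \<inter> U)) (\<lambda>y. v (inv_into U f y))"
  proof -
    have sub: "f ` (W \<inter> U) \<subseteq> V" using b by (auto simp: bij_betw_def)
    have "smooth_fun_on (open_submfd N V) (f ` (W \<inter> U)) (\<lambda>y. v (inv_into U f y))"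
    proof (rule smooth_fun_on_compose[OF _ _ s])
      show "smooth_fun_on (open_submfd M U) (W \<inter> U) v"
        using v by (auto simp: smooth_fun_on_open_submfd_iff[OF M] intro: smooth_fun_on_subset)
    qed (use M N U V sub inv in \<open>auto simp: smooth_manifold_open_submfd pts_open_submfd\<close>)
    with sub show ?thesis by (simp add: smooth_fun_on_open_submfd_iff[OF N])
  qed
  then have "smooth_fun_on N (f ` (W \<inter> U)) (\<lambda>y. v (inv_into W f y))"
    by (rule smooth_fun_on_cong[OF _ _ N]) (use W(2) inv in auto)
  moreover have "f ` W \<inter> f ` (W \<inter> U) = f ` (W \<inter> U)" by auto
  ultimately show "\<exists>V. openin (mtop N) V \<and> y \<in> V \<and>
      smooth_fun_on N (f ` W \<inter> V) (\<lambda>y. v (inv_into W f y))"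
    using x U by (intro exI[of _ "f ` (W \<inter> U)"]) auto
qed

section \<open>Pinors\<close>

text \<open>Isolates the fibrewise algebra of a principal Pin bundle. These conditions can be
  verified directly on orbits, so the arithmetic of pinors developed here applies to the quotient as
  well.\<close>

locale pinor_bundle =
  fixes \<epsilon> :: real and \<rho> :: "'m::{finite,linorder} cliff \<Rightarrow> complex^'s^'s"
    and P :: "('p, 'a, 'm) pin_struct"
  assumes clifford: "clifford_module \<epsilon> \<rho>"
    and pin_group: "group (Pin \<epsilon> :: 'm cliff monoid)"
    and act_one: "p \<in> total P \<Longrightarrow> act P p cl_one = p"
    and act_total: "p \<in> total P \<Longrightarrow> s \<in> pin_set \<epsilon> \<Longrightarrow> act P p s \<in> total P"
    and proj_act: "p \<in> total P \<Longrightarrow> s \<in> pin_set \<epsilon> \<Longrightarrow> proj P (act P p s) = proj P p"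
    and act_act: "p \<in> total P \<Longrightarrow> s \<in> pin_set \<epsilon> \<Longrightarrow> t \<in> pin_set \<epsilon> \<Longrightarrow>
      act P (act P p s) t = act P p (cl_mult \<epsilon> s t)"
    and act_free: "p \<in> total P \<Longrightarrow> s \<in> pin_set \<epsilon> \<Longrightarrow> t \<in> pin_set \<epsilon> \<Longrightarrow>
      act P p s = act P p t \<Longrightarrow> s = t"
    and act_transitive: "p \<in> total P \<Longrightarrow> q \<in> total P \<Longrightarrow> proj P p = proj P q \<Longrightarrow>
      \<exists>s\<in>pin_set \<epsilon>. q = act P p s"
begin

lemma pin_mult_closed: "s \<in> pin_set \<epsilon> \<Longrightarrow> t \<in> pin_set \<epsilon> \<Longrightarrow> cl_mult \<epsilon> s t \<in> pin_set \<epsilon>"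
  for s t :: "'m cliff"
  using monoid.m_closed[OF group.is_monoid[OF pin_group], of s t] by (simp add: Pin_def)

lemma pin_inverse:
  fixes s :: "'m cliff"
  assumes "s \<in> pin_set \<epsilon>"
  obtains t where "t \<in> pin_set \<epsilon>" "cl_mult \<epsilon> s t = cl_one" "cl_mult \<epsilon> t s = cl_one"
  using group.r_inv_ex[OF pin_group, of s] group.l_inv_ex[OF pin_group, of s]
    group.inv_closed[OF pin_group, of s] group.l_inv[OF pin_group, of s] group.r_inv[OF pin_group, of s] assms
  by (auto simp: Pin_def)

lemma rho_one: "\<rho> cl_one *v v = v"
  using clifford by (simp add: clifford_module_def)

lemma rho_mult: "\<rho> (cl_mult \<epsilon> s t) *v v = \<rho> s *v (\<rho> t *v v)"
  using clifford by (simp add: clifford_module_def matrix_vector_mul_assoc)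

lemma mem_pinor: "p \<in> total P \<Longrightarrow> (p, v) \<in> pinor \<epsilon> \<rho> P p v"
  unfolding pinor_def by (auto simp: act_one rho_one pin_set.intros(1) intro!: bexI[of _ cl_one])

text \<open>The substitution of \<open>cl_mult \<epsilon> s t\<close> for \<open>t\<close> permutes
  the Pin group and matches the two descriptions of the class; its inverse multiplies by
  \<open>s'\<close> on the left.\<close>

lemma pinor_act:
  assumes p: "p \<in> total P" and s: "s \<in> pin_set \<epsilon>"
  shows "pinor \<epsilon> \<rho> P (act P p s) v = pinor \<epsilon> \<rho> P p (\<rho> s *v v)"
proof -
  obtain s' where s': "s' \<in> pin_set \<epsilon>" "cl_mult \<epsilon> s s' = cl_one" "cl_mult \<epsilon> s' s = cl_one"
    using s by (rule pin_inverse)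
  have "(\<exists>t\<in>pin_set \<epsilon>. q = act P (act P p s) t \<and> v = \<rho> t *v w) \<longleftrightarrow>
      (\<exists>u\<in>pin_set \<epsilon>. q = act P p u \<and> \<rho> s *v v = \<rho> u *v w)" for q w
  proof
    assume "\<exists>t\<in>pin_set \<epsilon>. q = act P (act P p s) t \<and> v = \<rho> t *v w"
    then show "\<exists>u\<in>pin_set \<epsilon>. q = act P p u \<and> \<rho> s *v v = \<rho> u *v w"
      using p s by (auto simp: act_act rho_mult intro!: bexI[of _ "cl_mult \<epsilon> s _"] pin_mult_closed)
  next
    assume "\<exists>u\<in>pin_set \<epsilon>. q = act P p u \<and> \<rho> s *v v = \<rho> u *v w"
    then obtain u where u: "u \<in> pin_set \<epsilon>" "q = act P p u" "\<rho> s *v v = \<rho> u *v w" by blast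
    have "act P p u = act P (act P (act P p s) s') u"
      using p s s' by (simp add: act_act act_one)
    also have "\<dots> = act P (act P p s) (cl_mult \<epsilon> s' u)"
      by (rule act_act[OF act_total[OF p s] s'(1) u(1)])
    finally have "q = act P (act P p s) (cl_mult \<epsilon> s' u)" using u(2) by simp
    moreover have "v = \<rho> (cl_mult \<epsilon> s' u) *v w"
      by (simp add: rho_mult u(3)[symmetric]) (simp add: rho_mult[symmetric] s' rho_one)
    moreover have "cl_mult \<epsilon> s' u \<in> pin_set \<epsilon>" using s'(1) u(1) by (rule pin_mult_closed)
    ultimately show "\<exists>t\<in>pin_set \<epsilon>. q = act P (act P p s) t \<and> v = \<rho> t *v w" by blast
  qed
  then show ?thesis unfolding pinor_def by simp
qed

text \<open>Two representatives with the same frame differ by some \<open>s\<close> fixing that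
  frame, and freeness forces \<open>s = cl_one\<close>. So a frame identifies the fibre of pinors
  with the coordinate space.\<close>

lemma pinor_eq_iff:
  assumes "p \<in> total P"
  shows "pinor \<epsilon> \<rho> P p v = pinor \<epsilon> \<rho> P p w \<longleftrightarrow> v = w"
proof
  assume "pinor \<epsilon> \<rho> P p v = pinor \<epsilon> \<rho> P p w"
  with mem_pinor[OF assms] have "(p, v) \<in> pinor \<epsilon> \<rho> P p w" by blast
  then obtain s where s: "s \<in> pin_set \<epsilon>" "p = act P p s" "w = \<rho> s *v v"
    unfolding pinor_def by blast
  then have "s = cl_one"
    using act_free[OF assms s(1) pin_set.intros(1)] act_one[OF assms] by simp
  with s(3) show "v = w" by (simp add: rho_one)
qed simp

lemma pinor_eq_imp_act:
  assumes "pinor \<epsilon> \<rho> P p v = pinor \<epsilon> \<rho> P q w" "p \<in> total P"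
  obtains s where "s \<in> pin_set \<epsilon>" "p = act P q s"
  using mem_pinor[OF assms(2), of v] assms(1) unfolding pinor_def by blast

lemma pinor_change_frame:
  assumes "p \<in> total P" "q \<in> total P" "proj P p = proj P q"
  obtains s where "s \<in> pin_set \<epsilon>" "\<And>v. pinor \<epsilon> \<rho> P q v = pinor \<epsilon> \<rho> P p (\<rho> s *v v)"
  using act_transitive[OF assms] pinor_act[OF assms(1)] by metis

section \<open>Coordinates of pinors in a frame\<close>

text \<open>This is the expression whose smoothness along local sections defines the sections in
  \<open>pinor_sections\<close>.\<close>

definition coord :: "'p \<Rightarrow> ('p, 's) pinor \<Rightarrow> complex^'s" where
  "coord p S = (THE v. S = pinor \<epsilon> \<rho> P p v)"

lemma coord_pinor [simp]: "p \<in> total P \<Longrightarrow> coord p (pinor \<epsilon> \<rho> P p v) = v"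
  unfolding coord_def by (rule the_equality) (auto simp: pinor_eq_iff)

lemma pinor_coord:
  assumes "S \<in> pinor_fibre \<epsilon> \<rho> P x" "p \<in> total P" "proj P p = x"
  shows "pinor \<epsilon> \<rho> P p (coord p S) = S"
proof -
  obtain q v where q: "q \<in> total P" "proj P q = x" "S = pinor \<epsilon> \<rho> P q v"
    using assms(1) unfolding pinor_fibre_def by blast
  obtain s where "\<And>v. pinor \<epsilon> \<rho> P q v = pinor \<epsilon> \<rho> P p (\<rho> s *v v)"
    using pinor_change_frame[of p q] assms(2,3) q by metis
  with assms(2) q(3) show ?thesis by simp
qed

lemma pinor_in_fibre: "p \<in> total P \<Longrightarrow> pinor \<epsilon> \<rho> P p v \<in> pinor_fibre \<epsilon> \<rho> P (proj P p)"
  unfolding pinor_fibre_def by blast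

text \<open>Addition is defined by a common frame, and the point is independence of it: another
  frame has the form \<open>act P p s\<close>, and passing to it applies the linear map
  \<open>\<rho> s\<close> to both coordinates. Scalar multiplication works likewise, by complex
  linearity.\<close>

lemma pinor_add_pinor:
  assumes p: "p \<in> total P"
  shows "pinor_add \<epsilon> \<rho> P (pinor \<epsilon> \<rho> P p v) (pinor \<epsilon> \<rho> P p w) = pinor \<epsilon> \<rho> P p (v + w)"
  unfolding pinor_add_def
proof (rule the_equality)
  fix R assume "\<exists>q\<in>total P. \<exists>v' w'. pinor \<epsilon> \<rho> P p v = pinor \<epsilon> \<rho> P q v' \<and>
      pinor \<epsilon> \<rho> P p w = pinor \<epsilon> \<rho> P q w' \<and> R = pinor \<epsilon> \<rho> P q (v' + w')"
  then obtain q v' w' where q: "q \<in> total P" and v: "pinor \<epsilon> \<rho> P p v = pinor \<epsilon> \<rho> P q v'"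
    and w: "pinor \<epsilon> \<rho> P p w = pinor \<epsilon> \<rho> P q w'" and R: "R = pinor \<epsilon> \<rho> P q (v' + w')" by blast
  obtain s where s: "s \<in> pin_set \<epsilon>" "q = act P p s"
    using pinor_eq_imp_act[OF v[symmetric] q] .
  have "v = \<rho> s *v v'" "w = \<rho> s *v w'"
    using v w unfolding s(2) pinor_act[OF p s(1)] pinor_eq_iff[OF p] .
  with R s show "R = pinor \<epsilon> \<rho> P p (v + w)"
    by (simp add: pinor_act[OF p s(1)] matrix_vector_right_distrib)
qed (use p in blast)

lemma pinor_scale_pinor:
  assumes p: "p \<in> total P"
  shows "pinor_scale \<epsilon> \<rho> P z (pinor \<epsilon> \<rho> P p v) = pinor \<epsilon> \<rho> P p (z *s v)"
  unfolding pinor_scale_def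
proof (rule the_equality)
  fix R assume "\<exists>q\<in>total P. \<exists>v'. pinor \<epsilon> \<rho> P p v = pinor \<epsilon> \<rho> P q v' \<and> R = pinor \<epsilon> \<rho> P q (z *s v')"
  then obtain q v' where q: "q \<in> total P" and v: "pinor \<epsilon> \<rho> P p v = pinor \<epsilon> \<rho> P q v'"
    and R: "R = pinor \<epsilon> \<rho> P q (z *s v')" by blast
  obtain s where s: "s \<in> pin_set \<epsilon>" "q = act P p s"
    using pinor_eq_imp_act[OF v[symmetric] q] .
  have "v = \<rho> s *v v'"
    using v unfolding s(2) pinor_act[OF p s(1)] pinor_eq_iff[OF p] .
  with R s show "R = pinor \<epsilon> \<rho> P p (z *s v)"
    by (simp add: pinor_act[OF p s(1)] vector_scalar_commute)
qed (use p in blast)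

text \<open>By equivariance \<open>L\<close> carries the whole equivalence class of
  \<open>(p, v)\<close> onto that of \<open>(L p, v)\<close>, so taking the image of the set is the
  expected action.\<close>

lemma pinor_lift_pinor:
  assumes "p \<in> total P" "\<And>s. s \<in> pin_set \<epsilon> \<Longrightarrow> L (act P p s) = act P (L p) s"
  shows "pinor_lift L (pinor \<epsilon> \<rho> P p v) = pinor \<epsilon> \<rho> P (L p) v"
proof -
  have "(q, w) \<in> pinor_lift L (pinor \<epsilon> \<rho> P p v) \<longleftrightarrow> (\<exists>s\<in>pin_set \<epsilon>. q = L (act P p s) \<and> v = \<rho> s *v w)" for q w
    unfolding pinor_lift_def pinor_def by (auto simp: image_iff)
  then show ?thesis
    using assms unfolding pinor_def by auto
qed

lemma pinor_sections_iff:
  "s \<in> pinor_sections \<epsilon> \<rho> M P \<longleftrightarrow> s \<in> extensional (pts M) \<and>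
     (\<forall>x\<in>pts M. s x \<in> pinor_fibre \<epsilon> \<rho> P x) \<and>
     (\<forall>U \<sigma>. (U, \<sigma>) \<in> lsecs P \<longrightarrow> smooth_fun_on M U (\<lambda>x. coord (\<sigma> x) (s x)))"
  unfolding pinor_sections_def coord_def by auto

lemma pinor_coord_section:
  "s \<in> pinor_sections \<epsilon> \<rho> M P \<Longrightarrow> p \<in> total P \<Longrightarrow> proj P p \<in> pts M \<Longrightarrow>
    pinor \<epsilon> \<rho> P p (coord p (s (proj P p))) = s (proj P p)"
  by (rule pinor_coord) (simp_all add: pinor_sections_iff)

lemma section_add_frame:
  assumes "s \<in> pinor_sections \<epsilon> \<rho> M P" "t \<in> pinor_sections \<epsilon> \<rho> M P"
    "p \<in> total P" "proj P p \<in> pts M"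
  shows "section_add \<epsilon> \<rho> M P s t (proj P p) =
    pinor \<epsilon> \<rho> P p (coord p (s (proj P p)) + coord p (t (proj P p)))"
  using assms pinor_add_pinor[OF assms(3), of "coord p (s (proj P p))" "coord p (t (proj P p))"]
  by (simp add: section_add_def pinor_coord_section)

lemma section_scale_frame:
  assumes "s \<in> pinor_sections \<epsilon> \<rho> M P" "p \<in> total P" "proj P p \<in> pts M"
  shows "section_scale \<epsilon> \<rho> M P z s (proj P p) = pinor \<epsilon> \<rho> P p (z *s coord p (s (proj P p)))"
  using assms pinor_scale_pinor[OF assms(2), of z "coord p (s (proj P p))"]
  by (simp add: section_scale_def pinor_coord_section)

end

lemma bounded_linear_vector_scale: "bounded_linear (\<lambda>v::complex^'s. z *s v)"
  unfolding linear_conv_bounded_linear[symmetric]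
  by (rule linearI) (simp_all add: vec_eq_iff algebra_simps)

section \<open>Pinors on the quotient\<close>

text \<open>The map \<open>L\<close> enters as an equivariant involution of the total space covering
  \<tau>. These properties hold for both lifts, so one development yields both isomorphisms.\<close>

locale pin_quotient = pinor_bundle \<epsilon> \<rho> P
  for \<epsilon> :: real and \<rho> :: "'m::{finite,linorder} cliff \<Rightarrow> complex^'s^'s"
    and P :: "('p, 'y, 'm) pin_struct" +
  fixes X' :: "('y, 'm) rmfd" and X :: "('x, 'm) rmfd"
    and \<pi> :: "'y \<Rightarrow> 'x" and \<tau> :: "'y \<Rightarrow> 'y" and L :: "'p \<Rightarrow> 'p"
  assumes X': "smooth_manifold X'" and X: "smooth_manifold X"
    and covering: "double_covering X' X \<pi>"
    and \<tau>: "x \<in> pts X' \<Longrightarrow> \<tau> x \<in> pts X' \<and> \<tau> x \<noteq> x \<and> \<pi> (\<tau> x) = \<pi> x"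
    and proj_total: "p \<in> total P \<Longrightarrow> proj P p \<in> pts X'"
    and lsecs_cover: "x \<in> pts X' \<Longrightarrow> \<exists>(U, \<sigma>)\<in>lsecs P. x \<in> U"
    and lsecs_open: "(U, \<sigma>) \<in> lsecs P \<Longrightarrow> openin (mtop X') U"
    and lsecs_section: "(U, \<sigma>) \<in> lsecs P \<Longrightarrow> x \<in> U \<Longrightarrow> \<sigma> x \<in> total P \<and> proj P (\<sigma> x) = x"
    and L_total: "p \<in> total P \<Longrightarrow> L p \<in> total P"
    and L_L: "p \<in> total P \<Longrightarrow> L (L p) = p"
    and L_act: "p \<in> total P \<Longrightarrow> s \<in> pin_set \<epsilon> \<Longrightarrow> L (act P p s) = act P (L p) s"
    and proj_L: "p \<in> total P \<Longrightarrow> proj P (L p) = \<tau> (proj P p)"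
begin

abbreviation Q :: "('p set, 'x, 'm) pin_struct" where
  "Q \<equiv> quotient_pin X' X \<pi> P L"

lemma \<pi>_smooth: "smooth_map X' X \<pi>"
  using covering by (simp add: double_covering_def)

lemma \<pi>_pts: "x \<in> pts X' \<Longrightarrow> \<pi> x \<in> pts X"
  using \<pi>_smooth by (auto simp: smooth_map_def continuous_map_def)

text \<open>The fibre has exactly two points, and \<open>x\<close> and \<open>\<tau> x\<close> are
  distinct members of it. This identifies \<tau> as the sheet exchange.\<close>

lemma \<pi>_eq_iff:
  assumes "x \<in> pts X'" "x' \<in> pts X'"
  shows "\<pi> x = \<pi> x' \<longleftrightarrow> x' = x \<or> x' = \<tau> x"
proof
  assume "\<pi> x = \<pi> x'"
  obtain a b where "{z \<in> pts X'. \<pi> z = \<pi> x} = {a, b}"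
    using double_covering_fibre[OF covering \<pi>_pts[OF assms(1)]] by metis
  moreover have "x \<in> {z \<in> pts X'. \<pi> z = \<pi> x}" "\<tau> x \<in> {z \<in> pts X'. \<pi> z = \<pi> x}"
    "x' \<in> {z \<in> pts X'. \<pi> z = \<pi> x}"
    using assms \<tau> \<open>\<pi> x = \<pi> x'\<close> by auto
  ultimately show "x' = x \<or> x' = \<tau> x" using \<tau>[OF assms(1)] by auto
qed (use \<tau>[OF assms(1)] in auto)

lemma frame_exists:
  assumes "x \<in> pts X'"
  obtains p where "p \<in> total P" "proj P p = x"
  using lsecs_cover[OF assms] lsecs_section by blast

lemma quotient_frame_exists:
  assumes "y \<in> pts X"
  obtains p where "p \<in> total P" "\<pi> (proj P p) = y"
proof -
  obtain a b where "{z \<in> pts X'. \<pi> z = y} = {a, b}"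
    using double_covering_fibre[OF covering assms] by metis
  then have "a \<in> pts X'" "\<pi> a = y" by auto
  with that show ?thesis by (metis frame_exists)
qed

lemma same_fibre:
  assumes "p \<in> total P" "q \<in> total P" "\<pi> (proj P p) = \<pi> (proj P q)"
  shows "proj P q = proj P p \<or> proj P q = proj P (L p)"
  using assms by (simp add: \<pi>_eq_iff proj_total proj_L)

lemma orbit_eq_iff:
  "p \<in> total P \<Longrightarrow> q \<in> total P \<Longrightarrow> orbit L p = orbit L q \<longleftrightarrow> q = p \<or> q = L p"
  unfolding orbit_def by (metis L_L doubleton_eq_iff insertI1 singletonD insertE)

lemma total_Q: "total Q = orbit L ` total P"
  by (simp add: quotient_pin_def)

text \<open>The representative picked by \<open>SOME\<close> may be \<open>p\<close> or
  \<open>L p\<close>; their base points differ by \<tau>, which \<pi> does not see.\<close>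

lemma proj_Q:
  assumes "p \<in> total P"
  shows "proj Q (orbit L p) = \<pi> (proj P p)"
proof -
  have "(SOME q. q \<in> orbit L p) \<in> orbit L p"
    by (rule someI[of _ p]) (simp add: orbit_def)
  then have "(SOME q. q \<in> orbit L p) = p \<or> (SOME q. q \<in> orbit L p) = L p"
    by (simp add: orbit_def)
  then show ?thesis
    using assms \<tau>[OF proj_total[OF assms]] by (auto simp: quotient_pin_def proj_L)
qed

lemma act_Q: "p \<in> total P \<Longrightarrow> s \<in> pin_set \<epsilon> \<Longrightarrow> act Q (orbit L p) s = orbit L (act P p s)"
  by (simp add: quotient_pin_def orbit_def L_act)

sublocale Q: pinor_bundle \<epsilon> \<rho> Q
proof (rule pinor_bundle.intro)
  fix q assume "q \<in> total Q"
  then obtain p where p: "p \<in> total P" "q = orbit L p" by (auto simp: total_Q)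
  then show "act Q q cl_one = q" by (simp add: act_Q act_one pin_set.intros(1))
  fix s :: "'m cliff" assume s: "s \<in> pin_set \<epsilon>"
  show "act Q q s \<in> total Q" using p s by (simp add: act_Q total_Q act_total)
  show "proj Q (act Q q s) = proj Q q" using p s by (simp add: act_Q proj_Q act_total proj_act)
  fix t :: "'m cliff" assume t: "t \<in> pin_set \<epsilon>"
  show "act Q (act Q q s) t = act Q q (cl_mult \<epsilon> s t)"
    using p s t by (simp add: act_Q act_total act_act pin_mult_closed)
  assume "act Q q s = act Q q t"
  then have "act P p t = act P p s \<or> act P p t = L (act P p s)"
    using p s t by (simp add: act_Q orbit_eq_iff act_total)
  \<comment> \<open>Equality of orbits leaves a second possibility, excluded here because its two
    sides lie over \<open>\<tau> x\<close> and \<open>x\<close>.\<close>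
  moreover have "proj P (L (act P p s)) \<noteq> proj P (act P p t)"
    using p s t \<tau>[OF proj_total[OF p(1)]] by (simp add: proj_L act_total proj_act)
  ultimately have "act P p s = act P p t" by metis
  then show "s = t" by (rule act_free[OF p(1) s t])
next
  fix q q' assume "q \<in> total Q" "q' \<in> total Q" and eq: "proj Q q = proj Q q'"
  then obtain p p' where p: "p \<in> total P" "q = orbit L p" "p' \<in> total P" "q' = orbit L p'"
    by (auto simp: total_Q)
  with eq have "proj P p' = proj P p \<or> proj P p' = proj P (L p)"
    by (intro same_fibre) (simp_all add: proj_Q)
  then show "\<exists>s\<in>pin_set \<epsilon>. q' = act Q q s"
  proof
    assume "proj P p' = proj P p"
    then obtain s where "s \<in> pin_set \<epsilon>" "p' = act P p s" using act_transitive p by metis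
    with p show ?thesis by (intro bexI[of _ s]) (simp_all add: act_Q)
  next
    assume "proj P p' = proj P (L p)"
    then obtain s where s: "s \<in> pin_set \<epsilon>" "p' = act P (L p) s"
      using act_transitive[of "L p" p'] p L_total by metis
    \<comment> \<open>When \<open>p'\<close> lies over the other point of the fibre,
      \<open>L\<close> brings it back to \<open>act P p s\<close> without changing its
      orbit.\<close>
    then have "orbit L p' = orbit L (act P p s)"
      using p by (simp add: orbit_eq_iff act_total L_total L_act L_L)
    with p s show ?thesis by (intro bexI[of _ s]) (simp_all add: act_Q)
  qed
qed (use clifford pin_group in auto)

lemma orbit_total: "p \<in> total P \<Longrightarrow> orbit L p \<in> total Q"
  by (simp add: total_Q)

lemma orbit_L: "p \<in> total P \<Longrightarrow> orbit L (L p) = orbit L p"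
  by (simp add: orbit_eq_iff L_total L_L)

lemma lsecs_Q_iff:
  "(V, \<sigma>') \<in> lsecs Q \<longleftrightarrow> (\<exists>U W \<sigma>. V = \<pi> ` W \<and> \<sigma>' = (\<lambda>y. orbit L (\<sigma> (inv_into W \<pi> y))) \<and>
     (U, \<sigma>) \<in> lsecs P \<and> openin (mtop X') W \<and> W \<subseteq> U \<and> inj_on \<pi> W)"
  by (simp add: quotient_pin_def)

section \<open>Invariant sections and sections over the quotient\<close>

definition invariant_sections :: "('y \<Rightarrow> ('p, 's) pinor) set" where
  "invariant_sections =
     {s \<in> pinor_sections \<epsilon> \<rho> X' P. \<forall>x\<in>pts X'. s x = pinor_lift L (s (\<tau> x))}"

text \<open>Written in the frame \<open>L p\<close>, the value of \<open>s\<close> at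
  \<open>\<tau> x\<close> is lifted to a pinor in the frame \<open>L (L p) = p\<close> with the same
  coordinate. Comparing with \<open>s x\<close> in the frame \<open>p\<close> leaves an equality of
  coordinates.\<close>

lemma invariant_iff:
  assumes s: "s \<in> pinor_sections \<epsilon> \<rho> X' P"
  shows "(\<forall>x\<in>pts X'. s x = pinor_lift L (s (\<tau> x))) \<longleftrightarrow>
    (\<forall>p\<in>total P. coord (L p) (s (proj P (L p))) = coord p (s (proj P p)))"
proof -
  have frame: "s (proj P p) = pinor_lift L (s (\<tau> (proj P p))) \<longleftrightarrow>
      coord (L p) (s (proj P (L p))) = coord p (s (proj P p))" if p: "p \<in> total P" for p
  proof -
    note L = L_total[OF p]
    have "pinor_lift L (s (\<tau> (proj P p))) = pinor_lift L (pinor \<epsilon> \<rho> P (L p) (coord (L p) (s (proj P (L p)))))"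
      using pinor_coord_section[OF s L proj_total[OF L]] p by (simp add: proj_L)
    also have "\<dots> = pinor \<epsilon> \<rho> P p (coord (L p) (s (proj P (L p))))"
      using L by (simp add: pinor_lift_pinor L_act L_L[OF p])
    finally show ?thesis
      using pinor_coord_section[OF s p proj_total[OF p]] pinor_eq_iff[OF p] by metis
  qed
  show ?thesis
    using frame frame_exists proj_total by metis
qed

lemma coord_L:
  "s \<in> invariant_sections \<Longrightarrow> p \<in> total P \<Longrightarrow> coord (L p) (s (proj P (L p))) = coord p (s (proj P p))"
  using invariant_iff unfolding invariant_sections_def by blast

text \<open>The chosen frame may lie over either preimage of \<open>y\<close>; for invariant
  sections the value does not depend on this choice.\<close>

definition push_section :: "('y \<Rightarrow> ('p, 's) pinor) \<Rightarrow> 'x \<Rightarrow> ('p set, 's) pinor" where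
  "push_section s = restrict (\<lambda>y. let p = SOME p. p \<in> total P \<and> \<pi> (proj P p) = y
     in pinor \<epsilon> \<rho> Q (orbit L p) (coord p (s (proj P p)))) (pts X)"

definition pull_section :: "('x \<Rightarrow> ('p set, 's) pinor) \<Rightarrow> 'y \<Rightarrow> ('p, 's) pinor" where
  "pull_section t = restrict (\<lambda>x. let p = SOME p. p \<in> total P \<and> proj P p = x
     in pinor \<epsilon> \<rho> P p (Q.coord (orbit L p) (t (\<pi> x)))) (pts X')"

text \<open>Two frames over the same point differ by a Pin element, which acts compatibly on orbits
  and coordinates. A frame over the other point is compared with \<open>L p\<close>, which has the
  orbit of \<open>p\<close> and, by invariance, the same coordinate.\<close>

lemma push_section_frame:
  assumes s: "s \<in> invariant_sections" and p: "p \<in> total P"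
  shows "push_section s (\<pi> (proj P p)) = pinor \<epsilon> \<rho> Q (orbit L p) (coord p (s (proj P p)))"
proof -
  have s': "s \<in> pinor_sections \<epsilon> \<rho> X' P" using s by (simp add: invariant_sections_def)
  have change: "pinor \<epsilon> \<rho> Q (orbit L q) (coord q (s (proj P q))) =
      pinor \<epsilon> \<rho> Q (orbit L p) (coord p (s (proj P p)))"
    if p: "p \<in> total P" and q: "q \<in> total P" and pq: "proj P q = proj P p" for p q
  proof -
    obtain a where a: "a \<in> pin_set \<epsilon>" "q = act P p a" using act_transitive[OF p q] pq by auto
    define v where "v = coord q (s (proj P q))"
    have "pinor \<epsilon> \<rho> P p (\<rho> a *v v) = s (proj P p)"
      using pinor_coord_section[OF s' q proj_total[OF q]] pinor_act[OF p a(1), of v] a(2) pq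
      by (simp add: v_def)
    then have "coord p (s (proj P p)) = \<rho> a *v v" using coord_pinor[OF p] by metis
    then show ?thesis
      using Q.pinor_act[OF orbit_total[OF p] a(1), of v] a p by (simp add: act_Q v_def)
  qed
  define q where "q = (SOME q. q \<in> total P \<and> \<pi> (proj P q) = \<pi> (proj P p))"
  have "q \<in> total P \<and> \<pi> (proj P q) = \<pi> (proj P p)"
    unfolding q_def by (rule someI[of _ p]) (use p in simp)
  then have q: "q \<in> total P" "\<pi> (proj P p) = \<pi> (proj P q)" by simp_all
  have "push_section s (\<pi> (proj P p)) = pinor \<epsilon> \<rho> Q (orbit L q) (coord q (s (proj P q)))"
    using \<pi>_pts[OF proj_total[OF p]] by (simp add: push_section_def q_def Let_def)
  also have "\<dots> = pinor \<epsilon> \<rho> Q (orbit L p) (coord p (s (proj P p)))"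
    using same_fibre[OF p q]
  proof
    assume "proj P q = proj P (L p)"
    then have "pinor \<epsilon> \<rho> Q (orbit L q) (coord q (s (proj P q))) =
      pinor \<epsilon> \<rho> Q (orbit L (L p)) (coord (L p) (s (proj P (L p))))"
      by (intro change L_total p q)
    then show ?thesis using coord_L[OF s p] orbit_L[OF p] by simp
  qed (intro change p q)
  finally show ?thesis .
qed

lemma pull_section_frame:
  assumes t: "t \<in> pinor_sections \<epsilon> \<rho> X Q" and p: "p \<in> total P"
  shows "pull_section t (proj P p) = pinor \<epsilon> \<rho> P p (Q.coord (orbit L p) (t (\<pi> (proj P p))))"
proof -
  define q where "q = (SOME q. q \<in> total P \<and> proj P q = proj P p)"
  have "q \<in> total P \<and> proj P q = proj P p"
    unfolding q_def by (rule someI[of _ p]) (use p in simp)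
  then have q: "q \<in> total P" "proj P p = proj P q" by simp_all
  obtain a where a: "a \<in> pin_set \<epsilon>" "q = act P p a" using act_transitive[OF p q] by auto
  define v where "v = Q.coord (orbit L q) (t (\<pi> (proj P q)))"
  have "t (\<pi> (proj P p)) = pinor \<epsilon> \<rho> Q (orbit L p) (\<rho> a *v v)"
    using Q.pinor_coord_section[OF t orbit_total[OF q(1)]] \<pi>_pts[OF proj_total[OF q(1)]]
      Q.pinor_act[OF orbit_total[OF p] a(1), of v] a p q by (simp add: act_Q v_def proj_Q)
  then have "Q.coord (orbit L p) (t (\<pi> (proj P p))) = \<rho> a *v v"
    using orbit_total[OF p] by simp
  moreover have "pull_section t (proj P p) = pinor \<epsilon> \<rho> P q v"
    using proj_total[OF p] unfolding v_def q(2)[symmetric] by (simp add: pull_section_def q_def Let_def)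
  ultimately show ?thesis using pinor_act[OF p a(1), of v] a(2) by simp
qed

text \<open>Along a local section of \<open>Q\<close> induced by \<sigma>, the coordinate of the
  pushed section at \<open>y\<close> is that of \<open>s\<close> along \<sigma> at the preimage of
  \<open>y\<close> in \<open>W\<close>.\<close>

lemma push_section_smooth:
  assumes s: "s \<in> invariant_sections"
  shows "push_section s \<in> pinor_sections \<epsilon> \<rho> X Q"
  unfolding Q.pinor_sections_iff
proof (intro conjI ballI allI impI)
  have s': "s \<in> pinor_sections \<epsilon> \<rho> X' P" using s by (simp add: invariant_sections_def)
  show "push_section s \<in> extensional (pts X)" by (simp add: push_section_def)
  show "push_section s y \<in> pinor_fibre \<epsilon> \<rho> Q y" if y: "y \<in> pts X" for y
  proof -
    obtain p where "p \<in> total P" "\<pi> (proj P p) = y" using y by (rule quotient_frame_exists)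
    then show ?thesis
      using push_section_frame[OF s] Q.pinor_in_fibre[OF orbit_total] proj_Q by metis
  qed
  fix V \<sigma>' assume "(V, \<sigma>') \<in> lsecs Q"
  then obtain U W \<sigma> where V: "V = \<pi> ` W" and \<sigma>': "\<sigma>' = (\<lambda>y. orbit L (\<sigma> (inv_into W \<pi> y)))"
    and U: "(U, \<sigma>) \<in> lsecs P" and W: "openin (mtop X') W" "W \<subseteq> U" "inj_on \<pi> W"
    unfolding lsecs_Q_iff by blast
  have "smooth_fun_on X' U (\<lambda>x. coord (\<sigma> x) (s x))"
    using s' U by (simp add: pinor_sections_iff)
  then have "smooth_fun_on X' W (\<lambda>x. coord (\<sigma> x) (s x))"
    using W(2) by (rule smooth_fun_on_subset)
  then have "smooth_fun_on X (\<pi> ` W) (\<lambda>y. coord (\<sigma> (inv_into W \<pi> y)) (s (inv_into W \<pi> y)))"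
    by (rule double_covering_push_smooth_fun[OF X' X covering W(1,3)])
  then show "smooth_fun_on X V (\<lambda>y. Q.coord (\<sigma>' y) (push_section s y))"
    unfolding V
  proof (rule smooth_fun_on_cong[OF _ _ X])
    fix y assume "y \<in> \<pi> ` W"
    then obtain x where x: "x \<in> W" "y = \<pi> x" by blast
    with lsecs_section[OF U, of x] W have p: "\<sigma> x \<in> total P" "proj P (\<sigma> x) = x" by auto
    show "coord (\<sigma> (inv_into W \<pi> y)) (s (inv_into W \<pi> y)) = Q.coord (\<sigma>' y) (push_section s y)"
      using push_section_frame[OF s p(1)] p x W(3) by (simp add: \<sigma>' orbit_total)
  qed
qed

lemma pull_section_smooth:
  assumes t: "t \<in> pinor_sections \<epsilon> \<rho> X Q"
  shows "pull_section t \<in> invariant_sections"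
proof -
  have "pull_section t \<in> pinor_sections \<epsilon> \<rho> X' P"
    unfolding pinor_sections_iff
  proof (intro conjI ballI allI impI)
    show "pull_section t \<in> extensional (pts X')" by (simp add: pull_section_def)
    show "pull_section t x \<in> pinor_fibre \<epsilon> \<rho> P x" if x: "x \<in> pts X'" for x
    proof -
      obtain p where "p \<in> total P" "proj P p = x" using x by (rule frame_exists)
      then show ?thesis using pull_section_frame[OF t] pinor_in_fibre by metis
    qed
    fix U \<sigma> assume U: "(U, \<sigma>) \<in> lsecs P"
    show "smooth_fun_on X' U (\<lambda>x. coord (\<sigma> x) (pull_section t x))"
    proof (rule smooth_fun_on_local[OF X'])
      fix x assume x: "x \<in> U"
      then have "x \<in> pts X'" using lsecs_open[OF U] by (auto dest: openin_subset)
      with covering obtain U1 V where U1: "openin (mtop X') U1" "x \<in> U1" and V: "openin (mtop X) V"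
        and d: "diffeomorphism (open_submfd X' U1) (open_submfd X V) \<pi>"
        by (rule double_covering_sheet)
      \<comment> \<open>Cutting \<open>U\<close> down to one sheet removes possible pairs
        \<open>x\<close>, \<open>\<tau> x\<close>, so that \<sigma> induces a local section of
        \<open>Q\<close> in which the smoothness of \<open>t\<close> can be used.\<close>
      have inj: "inj_on \<pi> (U \<inter> U1)"
        using d U1 by (auto simp: diffeomorphism_def pts_open_submfd bij_betw_def intro: inj_on_subset)
      let ?W = "U \<inter> U1" and ?\<sigma>' = "\<lambda>y. orbit L (\<sigma> (inv_into (U \<inter> U1) \<pi> y))"
      have W: "openin (mtop X') ?W" using lsecs_open[OF U] U1 by blast
      with U inj have "(\<pi> ` ?W, ?\<sigma>') \<in> lsecs Q" unfolding lsecs_Q_iff by blast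
      then have "smooth_fun_on X (\<pi> ` ?W) (\<lambda>y. Q.coord (?\<sigma>' y) (t y))"
        using t unfolding Q.pinor_sections_iff by blast
      then have "smooth_fun_on X' ?W (\<lambda>x. Q.coord (?\<sigma>' (\<pi> x)) (t (\<pi> x)))"
        by (rule smooth_fun_on_compose[OF X' X \<pi>_smooth]) (use openin_subset[OF W] in auto)
      then have "smooth_fun_on X' ?W (\<lambda>x. coord (\<sigma> x) (pull_section t x))"
      proof (rule smooth_fun_on_cong[OF _ _ X'])
        fix x assume x: "x \<in> ?W"
        with lsecs_section[OF U, of x] have p: "\<sigma> x \<in> total P" "proj P (\<sigma> x) = x" by auto
        show "Q.coord (?\<sigma>' (\<pi> x)) (t (\<pi> x)) = coord (\<sigma> x) (pull_section t x)"
          using pull_section_frame[OF t p(1)] p x inj by simp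
      qed
      with U1 show "\<exists>V. openin (mtop X') V \<and> x \<in> V \<and>
          smooth_fun_on X' (U \<inter> V) (\<lambda>x. coord (\<sigma> x) (pull_section t x))" by blast
    qed
  qed
  \<comment> \<open>Invariance is automatic: \<open>p\<close> and \<open>L p\<close> have the same
    orbit and lie over the same point of \<open>X\<close>, so they read off the same coordinate of
    \<open>t\<close>.\<close>
  then show ?thesis
    unfolding invariant_sections_def
    by (simp add: invariant_iff pull_section_frame[OF t] L_total orbit_L)
      (use \<tau> proj_total in \<open>auto simp: proj_L\<close>)
qed

lemma section_eqI:
  assumes "s \<in> pinor_sections \<epsilon> \<rho> X' P" "t \<in> pinor_sections \<epsilon> \<rho> X' P"
    "\<And>p. p \<in> total P \<Longrightarrow> s (proj P p) = t (proj P p)"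
  shows "s = t"
proof (rule extensionalityI[of _ "pts X'"])
  show "s x = t x" if "x \<in> pts X'" for x
    using assms(3) frame_exists[OF that] by metis
qed (use assms in \<open>auto simp: pinor_sections_iff\<close>)

lemma Q_section_eqI:
  assumes "s \<in> extensional (pts X)" "t \<in> extensional (pts X)"
    "\<And>p. p \<in> total P \<Longrightarrow> s (\<pi> (proj P p)) = t (\<pi> (proj P p))"
  shows "s = t"
proof (rule extensionalityI[OF assms(1,2)])
  show "s y = t y" if "y \<in> pts X" for y
    using assms(3) quotient_frame_exists[OF that] by metis
qed

text \<open>Both constructions preserve coordinates, that is, the coordinate in \<open>p\<close>
  upstairs equals the one in \<open>orbit L p\<close> downstairs. So they are inverse to each other
  at every frame, and extensionality settles the values elsewhere.\<close>

lemma push_section_bij: "bij_betw push_section invariant_sections (pinor_sections \<epsilon> \<rho> X Q)"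
proof (rule bij_betw_byWitness[where f' = pull_section])
  show "push_section ` invariant_sections \<subseteq> pinor_sections \<epsilon> \<rho> X Q"
    using push_section_smooth by blast
  show "pull_section ` pinor_sections \<epsilon> \<rho> X Q \<subseteq> invariant_sections"
    using pull_section_smooth by blast
  show "\<forall>s\<in>invariant_sections. pull_section (push_section s) = s"
  proof
    fix s assume s: "s \<in> invariant_sections"
    then have s': "s \<in> pinor_sections \<epsilon> \<rho> X' P" by (simp add: invariant_sections_def)
    note t = push_section_smooth[OF s]
    show "pull_section (push_section s) = s"
    proof (rule section_eqI[OF _ s'])
      show "pull_section (push_section s) \<in> pinor_sections \<epsilon> \<rho> X' P"
        using pull_section_smooth[OF t] by (simp add: invariant_sections_def)
      show "pull_section (push_section s) (proj P p) = s (proj P p)" if "p \<in> total P" for p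
        using that by (simp add: pull_section_frame[OF t] push_section_frame[OF s] orbit_total
            pinor_coord_section[OF s'] proj_total)
    qed
  qed
  show "\<forall>t\<in>pinor_sections \<epsilon> \<rho> X Q. push_section (pull_section t) = t"
  proof
    fix t assume t: "t \<in> pinor_sections \<epsilon> \<rho> X Q"
    note s = pull_section_smooth[OF t]
    show "push_section (pull_section t) = t"
    proof (rule Q_section_eqI)
      show "push_section (pull_section t) (\<pi> (proj P p)) = t (\<pi> (proj P p))" if p: "p \<in> total P" for p
        using p Q.pinor_coord_section[OF t orbit_total[OF p]] \<pi>_pts[OF proj_total[OF p]]
        by (simp add: push_section_frame[OF s] pull_section_frame[OF t] proj_Q)
    qed (use t in \<open>auto simp: push_section_def Q.pinor_sections_iff\<close>)
  qed
qed

section \<open>Vector space structure\<close>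

text \<open>Reduces closure under sums and multiples to coordinate functions. The equivariance of
  \<open>w\<close> is implicit in \<open>frame\<close>, whose left side depends only on the base
  point.\<close>

lemma invariant_sections_of_coord:
  assumes ext: "u \<in> extensional (pts X')"
    and frame: "\<And>p. p \<in> total P \<Longrightarrow> u (proj P p) = pinor \<epsilon> \<rho> P p (w p)"
    and inv: "\<And>p. p \<in> total P \<Longrightarrow> w (L p) = w p"
    and smooth: "\<And>U \<sigma>. (U, \<sigma>) \<in> lsecs P \<Longrightarrow> smooth_fun_on X' U (\<lambda>x. w (\<sigma> x))"
  shows "u \<in> invariant_sections"
proof -
  have "u \<in> pinor_sections \<epsilon> \<rho> X' P"
    unfolding pinor_sections_iff
  proof (intro conjI ballI allI impI ext)
    show "u x \<in> pinor_fibre \<epsilon> \<rho> P x" if x: "x \<in> pts X'" for x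
    proof -
      obtain p where "p \<in> total P" "proj P p = x" using x by (rule frame_exists)
      then show ?thesis using frame pinor_in_fibre by metis
    qed
    fix U \<sigma> assume U: "(U, \<sigma>) \<in> lsecs P"
    show "smooth_fun_on X' U (\<lambda>x. coord (\<sigma> x) (u x))"
    proof (rule smooth_fun_on_cong[OF smooth[OF U] _ X'])
      show "w (\<sigma> x) = coord (\<sigma> x) (u x)" if "x \<in> U" for x
        using lsecs_section[OF U that] frame[of "\<sigma> x"] by simp
    qed
  qed
  then show ?thesis
    by (simp add: invariant_sections_def invariant_iff frame L_total inv)
qed

lemma section_add_invariant:
  assumes "s \<in> invariant_sections" "t \<in> invariant_sections"
  shows "section_add \<epsilon> \<rho> X' P s t \<in> invariant_sections"
proof -
  have s: "s \<in> pinor_sections \<epsilon> \<rho> X' P" "t \<in> pinor_sections \<epsilon> \<rho> X' P"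
    using assms by (simp_all add: invariant_sections_def)
  have ext: "section_add \<epsilon> \<rho> X' P s t \<in> extensional (pts X')"
    by (simp add: section_add_def)
  show ?thesis
  proof (rule invariant_sections_of_coord[where w = "\<lambda>p. coord p (s (proj P p)) + coord p (t (proj P p))"])
    fix U \<sigma> assume U: "(U, \<sigma>) \<in> lsecs P"
    with s have "smooth_fun_on X' U (\<lambda>x. coord (\<sigma> x) (s x) + coord (\<sigma> x) (t x))"
      by (intro smooth_fun_on_add) (simp_all add: pinor_sections_iff)
    then show "smooth_fun_on X' U (\<lambda>x. coord (\<sigma> x) (s (proj P (\<sigma> x))) + coord (\<sigma> x) (t (proj P (\<sigma> x))))"
      by (rule smooth_fun_on_cong[OF _ _ X']) (use lsecs_section[OF U] in simp)
  qed (use s in \<open>auto simp: section_add_frame proj_total coord_L assms ext\<close>)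
qed

lemma section_scale_invariant:
  assumes "s \<in> invariant_sections"
  shows "section_scale \<epsilon> \<rho> X' P z s \<in> invariant_sections"
proof -
  have s: "s \<in> pinor_sections \<epsilon> \<rho> X' P"
    using assms by (simp_all add: invariant_sections_def)
  have ext: "section_scale \<epsilon> \<rho> X' P z s \<in> extensional (pts X')"
    by (simp add: section_scale_def)
  show ?thesis
  proof (rule invariant_sections_of_coord[where w = "\<lambda>p. z *s coord p (s (proj P p))"])
    fix U \<sigma> assume U: "(U, \<sigma>) \<in> lsecs P"
    with s have "smooth_fun_on X' U (\<lambda>x. z *s coord (\<sigma> x) (s x))"
      by (intro smooth_fun_on_linear[OF _ bounded_linear_vector_scale]) (simp_all add: pinor_sections_iff)
    then show "smooth_fun_on X' U (\<lambda>x. z *s coord (\<sigma> x) (s (proj P (\<sigma> x))))"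
      by (rule smooth_fun_on_cong[OF _ _ X']) (use lsecs_section[OF U] in simp)
  qed (use s in \<open>auto simp: section_scale_frame proj_total coord_L assms ext\<close>)
qed

text \<open>In a frame and in its orbit both structures are those of the same coordinate space, and
  pushing leaves coordinates unchanged.\<close>

lemma push_section_linear_iso:
  "complex_linear_iso invariant_sections (section_add \<epsilon> \<rho> X' P) (section_scale \<epsilon> \<rho> X' P)
     (pinor_sections \<epsilon> \<rho> X Q) (section_add \<epsilon> \<rho> X Q) (section_scale \<epsilon> \<rho> X Q) push_section"
  unfolding complex_linear_iso_def
proof (intro conjI ballI allI push_section_bij section_add_invariant section_scale_invariant)
  fix s assume s: "s \<in> invariant_sections"
  then have s': "s \<in> pinor_sections \<epsilon> \<rho> X' P" by (simp add: invariant_sections_def)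
  fix t assume t: "t \<in> invariant_sections"
  then have t': "t \<in> pinor_sections \<epsilon> \<rho> X' P" by (simp add: invariant_sections_def)
  show "push_section (section_add \<epsilon> \<rho> X' P s t) = section_add \<epsilon> \<rho> X Q (push_section s) (push_section t)"
  proof (rule Q_section_eqI)
    fix p assume p: "p \<in> total P"
    show "push_section (section_add \<epsilon> \<rho> X' P s t) (\<pi> (proj P p)) =
        section_add \<epsilon> \<rho> X Q (push_section s) (push_section t) (\<pi> (proj P p))"
      using Q.section_add_frame[OF push_section_smooth[OF s] push_section_smooth[OF t] orbit_total[OF p]]
        \<pi>_pts[OF proj_total[OF p]] p
      by (simp add: push_section_frame section_add_invariant s t section_add_frame[OF s' t'] proj_Q
          proj_total orbit_total)
  qed (simp_all add: push_section_def section_add_def)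
next
  fix z s assume s: "s \<in> invariant_sections"
  then have s': "s \<in> pinor_sections \<epsilon> \<rho> X' P" by (simp add: invariant_sections_def)
  show "push_section (section_scale \<epsilon> \<rho> X' P z s) = section_scale \<epsilon> \<rho> X Q z (push_section s)"
  proof (rule Q_section_eqI)
    fix p assume p: "p \<in> total P"
    show "push_section (section_scale \<epsilon> \<rho> X' P z s) (\<pi> (proj P p)) =
        section_scale \<epsilon> \<rho> X Q z (push_section s) (\<pi> (proj P p))"
      using Q.section_scale_frame[OF push_section_smooth[OF s] orbit_total[OF p]]
        \<pi>_pts[OF proj_total[OF p]] p
      by (simp add: push_section_frame section_scale_invariant s section_scale_frame[OF s'] proj_Q
          proj_total orbit_total)
  qed (simp_all add: push_section_def section_scale_def)
qed

text \<open>This expresses naturality: every value of an invariant section has a coordinate in each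
  frame, so the rule determines the induced section at all points of \<open>X\<close>.\<close>

lemma push_section_induced:
  "induced_by_quotient \<epsilon> \<rho> X' X \<pi> P L invariant_sections push_section"
  unfolding induced_by_quotient_def by (simp add: push_section_frame)

end

section \<open>The two lifts\<close>

text \<open>For a unit vector \<open>v\<close>, the products of \<open>v\<close> with
  \<open>v\<close> and with \<open>- v\<close> are \<epsilon> and its negative; for either sign one
  of them is the required element. Any coordinate vector serves as \<open>v\<close>, and an index
  exists because types are inhabited.\<close>

lemma minus_one_in_pin_set:
  assumes "\<epsilon> = 1 \<or> \<epsilon> = -1"
  shows "- cl_one \<in> (pin_set \<epsilon> :: 'm::{finite,linorder} cliff set)"
proof -
  note b = bilinear_cl_mult[of \<epsilon>]
  define v :: "real^'m::{finite,linorder}" where "v = axis undefined 1"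
  have v: "norm v = 1" by (simp add: v_def)
  have "cl_mult \<epsilon> (cl_mult \<epsilon> cl_one (cl_vec v)) (cl_vec w) \<in> pin_set \<epsilon>" if "norm w = 1" for w
    by (intro pin_set.intros v that)
  from this[of v] this[of "- v"] v
  have "cl_mult \<epsilon> (cl_vec v) (cl_vec v) \<in> pin_set \<epsilon>" "cl_mult \<epsilon> (cl_vec v) (cl_vec (- v)) \<in> pin_set \<epsilon>"
    by (simp_all add: cl_mult_one)
  moreover have "cl_vec (- v) = - cl_vec v"
    by (simp add: cl_vec_def sum_negf)
  ultimately show ?thesis
    using assms v by (auto simp: cl_vec_square bilinear_rneg[OF b])
qed

lemma principal_bundleD:
  assumes "principal_bundle M G P"
  shows "group G" "proj P ` total P \<subseteq> pts M" "\<forall>p\<in>total P. act P p \<one>\<^bsub>G\<^esub> = p"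
    "\<forall>p\<in>total P. \<forall>s\<in>carrier G. act P p s \<in> total P \<and> proj P (act P p s) = proj P p"
    "\<forall>p\<in>total P. \<forall>s\<in>carrier G. \<forall>t\<in>carrier G. act P (act P p s) t = act P p (s \<otimes>\<^bsub>G\<^esub> t)"
    "\<forall>p\<in>total P. \<forall>q\<in>total P. proj P p = proj P q \<longrightarrow> (\<exists>!s. s \<in> carrier G \<and> q = act P p s)"
    "(\<Union>l\<in>lsecs P. fst l) = pts M"
    "\<forall>(U, \<sigma>)\<in>lsecs P. openin (mtop M) U \<and> (\<forall>x\<in>U. \<sigma> x \<in> total P \<and> proj P (\<sigma> x) = x)"
  using assms unfolding principal_bundle_def by - (elim conjE, assumption)+

text \<open>The total space is open in the topology induced by its trivialisations. Hence a
  diffeomorphism of \<open>total_mfd\<close> is a bijection of \<open>total P\<close>, which is how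
  a lift is known to preserve it.\<close>

lemma pts_total_mfd:
  assumes "principal_bundle M G P"
  shows "pts (total_mfd M G P) = total P"
proof -
  note P = principal_bundleD[OF assms]
  have "bundle_open M G P (total P)"
    unfolding bundle_open_def
  proof (intro conjI ballI subset_refl, clarify)
    fix U \<sigma> assume "(U, \<sigma>) \<in> lsecs P"
    with P(8) have "\<forall>x\<in>U. \<sigma> x \<in> total P" by blast
    with P(4) have "{(x, s). x \<in> pts M \<inter> U \<and> s \<in> carrier G \<and> act P (\<sigma> x) s \<in> total P} =
        topspace (prod_topology (subtopology (mtop M) U) (top_of_set (carrier G)))"
      by auto
    then show "openin (prod_topology (subtopology (mtop M) U) (top_of_set (carrier G)))
        {(x, s). x \<in> pts M \<inter> U \<and> s \<in> carrier G \<and> act P (\<sigma> x) s \<in> total P}"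
      by (simp only: openin_topspace)
  qed
  moreover have "W \<subseteq> total P" if "bundle_open M G P W" for W
    using that by (simp add: bundle_open_def)
  ultimately show ?thesis
    unfolding total_mfd_def topspace_def
    by (auto simp: topology_inverse'[OF istopology_bundle_open])
qed

lemma pinor_bundle_of_principal_bundle:
  assumes "principal_bundle M (Pin \<epsilon>) P" and "clifford_module \<epsilon> (\<rho> :: 'm::{finite,linorder} cliff \<Rightarrow> complex^'s^'s)"
  shows "pinor_bundle \<epsilon> \<rho> P"
proof (rule pinor_bundle.intro)
  note P = principal_bundleD[OF assms(1)]
  have carrier: "carrier (Pin \<epsilon>) = (pin_set \<epsilon> :: 'm cliff set)" by (simp add: Pin_def)
  show "group (Pin \<epsilon> :: 'm cliff monoid)" by (rule P(1))
  show "clifford_module \<epsilon> \<rho>" by (rule assms(2))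
  fix p assume p: "p \<in> total P"
  show "act P p cl_one = p" using P(3) p by (simp add: Pin_def)
  {
    fix q assume "q \<in> total P" "proj P p = proj P q"
    with P(6) p have "\<exists>!s. s \<in> pin_set \<epsilon> \<and> q = act P p s" unfolding carrier by blast
    then show "\<exists>s\<in>pin_set \<epsilon>. q = act P p s" by blast
  }
  fix s :: "'m cliff" assume s: "s \<in> pin_set \<epsilon>"
  show total: "act P p s \<in> total P" and proj: "proj P (act P p s) = proj P p"
    using P(4) p s unfolding carrier by blast+
  fix t :: "'m cliff" assume t: "t \<in> pin_set \<epsilon>"
  show "act P (act P p s) t = act P p (cl_mult \<epsilon> s t)"
    using P(5) p s t by (simp add: Pin_def)
  assume "act P p s = act P p t"
  moreover have "\<exists>!u. u \<in> pin_set \<epsilon> \<and> act P p s = act P p u"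
    using P(6) p total proj unfolding carrier by simp
  ultimately show "s = t" using s t by blast
qed

context pinor_bundle
begin

text \<open>Centrality makes the sheet exchange commute with the Pin action, so composing a lift
  with it keeps equivariance.\<close>

lemma minus_one_central:
  "cl_mult \<epsilon> (- cl_one) s = - s" "cl_mult \<epsilon> s (- cl_one) = - s" for s :: "'m cliff"
  by (simp_all add: bilinear_lneg[OF bilinear_cl_mult] bilinear_rneg[OF bilinear_cl_mult] cl_mult_one)

lemma rho_minus_one: "\<rho> (- cl_one) *v v = - v"
proof -
  have "\<rho> (- cl_one) = 0 - mat 1"
    using clifford by (simp add: clifford_module_def linear_neg)
  then show ?thesis by (simp only: matrix_vector_mult_diff_rdistrib) simp
qed

end

theorem mainTheorem3:
  fixes n :: nat
    and X :: "('x, 'm::{finite,linorder}) rmfd"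
    and X' :: "('y, 'm) rmfd"
    and g :: "('x, 'm) metric"
    and \<pi> :: "'y \<Rightarrow> 'x"
    and \<tau> :: "'y \<Rightarrow> 'y"
    and \<epsilon> :: real
    and P :: "('p, 'y, 'm) pin_struct"
    and d\<tau> :: "'p \<Rightarrow> 'p"
    and \<rho> :: "'m cliff \<Rightarrow> complex^'s^'s"
  assumes dim: "CARD('m) = 2 * n" "CARD('s) = 2 ^ n"
    and X: "smooth_manifold X" "connected_space (mtop X)" "\<not> orientable X"
    and g: "riemannian_metric X g"
    and X': "smooth_manifold X'" "orientable X'" "double_covering X' X \<pi>"
    and \<tau>: "\<forall>x\<in>pts X'. \<tau> x \<in> pts X' \<and> \<tau> x \<noteq> x \<and> \<pi> (\<tau> x) = \<pi> x"
    and \<epsilon>: "\<epsilon> = 1 \<or> \<epsilon> = -1"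
    and P: "pin_structure \<epsilon> X' (pullback_metric X' X \<pi> g) P"
    and lift: "pin_lift \<epsilon> X' P \<tau> d\<tau>"
    and square: "\<forall>p\<in>total P. d\<tau> (d\<tau> p) = p"
      "\<forall>p\<in>total P. (d\<tau> \<circ> sheet_exchange P) ((d\<tau> \<circ> sheet_exchange P) p) = p"
    and \<rho>: "clifford_module \<epsilon> \<rho>"
  shows
    "(\<exists>\<Phi>.
        let V = {s \<in> pinor_sections \<epsilon> \<rho> X' P.
                   \<forall>x\<in>pts X'. s x = pinor_lift d\<tau> (s (\<tau> x))};
            L = d\<tau>;
            Q = quotient_pin X' X \<pi> P L
        in complex_linear_iso
             V (section_add \<epsilon> \<rho> X' P) (section_scale \<epsilon> \<rho> X' P)
             (pinor_sections \<epsilon> \<rho> X Q) (section_add \<epsilon> \<rho> X Q) (section_scale \<epsilon> \<rho> X Q) \<Phi> \<and>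
           induced_by_quotient \<epsilon> \<rho> X' X \<pi> P L V \<Phi>) \<and>
     (\<exists>\<Phi>.
        let V = {s \<in> pinor_sections \<epsilon> \<rho> X' P.
                   \<forall>x\<in>pts X'. s x = pinor_scale \<epsilon> \<rho> P (-1) (pinor_lift d\<tau> (s (\<tau> x)))};
            L = d\<tau> \<circ> sheet_exchange P;
            Q = quotient_pin X' X \<pi> P L
        in complex_linear_iso
             V (section_add \<epsilon> \<rho> X' P) (section_scale \<epsilon> \<rho> X' P)
             (pinor_sections \<epsilon> \<rho> X Q) (section_add \<epsilon> \<rho> X Q) (section_scale \<epsilon> \<rho> X Q) \<Phi> \<and>
           induced_by_quotient \<epsilon> \<rho> X' X \<pi> P L V \<Phi>)"
proof -
  have principal: "principal_bundle X' (Pin \<epsilon>) P" using P by (simp add: pin_structure_def)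
  note minus_one = minus_one_in_pin_set[OF \<epsilon>, where 'm = 'm]
  interpret pinor_bundle \<epsilon> \<rho> P
    by (rule pinor_bundle_of_principal_bundle[OF principal \<rho>])
  have d\<tau>_total: "d\<tau> p \<in> total P" if "p \<in> total P" for p
    using lift that
    by (auto simp: pin_lift_def diffeomorphism_def pts_total_mfd[OF principal] bij_betw_def)
  have d\<tau>_act: "d\<tau> (act P p s) = act P (d\<tau> p) s" if "p \<in> total P" "s \<in> pin_set \<epsilon>" for p s
    using lift that by (simp add: pin_lift_def)
  have fst_cover: "fst (cover P p) = proj P p" if "p \<in> total P" for p
    using P that by (simp add: pin_structure_def frame_bundle_def)
  \<comment> \<open>A lift is constrained through the frames it covers; its effect on base points is
    read off from the first component of a frame.\<close>
  have proj_d\<tau>: "proj P (d\<tau> p) = \<tau> (proj P p)" if "p \<in> total P" for p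
  proof -
    have "cover P (d\<tau> p) = frame_map X' X' \<tau> (cover P p)"
      using lift that by (simp add: pin_lift_def)
    then have "fst (cover P (d\<tau> p)) = \<tau> (fst (cover P p))"
      by (simp add: frame_map_def split_beta)
    with that show ?thesis by (simp add: fst_cover d\<tau>_total)
  qed
  have quotient: "pin_quotient \<epsilon> \<rho> P X' X \<pi> \<tau> L"
    if "\<And>p. p \<in> total P \<Longrightarrow> L p \<in> total P" "\<And>p. p \<in> total P \<Longrightarrow> L (L p) = p"
      "\<And>p s. p \<in> total P \<Longrightarrow> s \<in> pin_set \<epsilon> \<Longrightarrow> L (act P p s) = act P (L p) s"
      "\<And>p. p \<in> total P \<Longrightarrow> proj P (L p) = \<tau> (proj P p)" for L
  proof (intro pin_quotient.intro pin_quotient_axioms.intro X'(1,3) X(1))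
    show "pinor_bundle \<epsilon> \<rho> P" by unfold_locales
    show "\<exists>(U, \<sigma>)\<in>lsecs P. x \<in> U" if "x \<in> pts X'" for x
    proof -
      have "x \<in> (\<Union>l\<in>lsecs P. fst l)" using principal_bundleD(7)[OF principal] that by simp
      then show ?thesis by auto
    qed
    note lsecs = principal_bundleD(8)[OF principal]
    show "openin (mtop X') U" if "(U, \<sigma>) \<in> lsecs P" for U \<sigma> using lsecs that by blast
    show "\<sigma> x \<in> total P \<and> proj P (\<sigma> x) = x" if "(U, \<sigma>) \<in> lsecs P" "x \<in> U" for U \<sigma> x
      using lsecs that by blast
    show "proj P p \<in> pts X'" if "p \<in> total P" for p
      using principal_bundleD(2)[OF principal] that by blast
  qed (use \<tau> that in auto)

  interpret A: pin_quotient \<epsilon> \<rho> P X' X \<pi> \<tau> d\<tau>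
    by (rule quotient) (use d\<tau>_total square d\<tau>_act proj_d\<tau> in auto)
  \<comment> \<open>Equivariance moves the factor -1 outside the lift, where it can be handled by
    the action axioms.\<close>
  have exch: "(d\<tau> \<circ> sheet_exchange P) p = act P (d\<tau> p) (- cl_one)" if "p \<in> total P" for p
    using that by (simp add: sheet_exchange_def d\<tau>_act minus_one)
  have exch_act: "(d\<tau> \<circ> sheet_exchange P) (act P p s) = act P ((d\<tau> \<circ> sheet_exchange P) p) s"
    if "p \<in> total P" "s \<in> pin_set \<epsilon>" for p s
    using that by (simp add: exch act_total d\<tau>_total d\<tau>_act act_act minus_one minus_one_central del: o_apply)
  interpret B: pin_quotient \<epsilon> \<rho> P X' X \<pi> \<tau> "d\<tau> \<circ> sheet_exchange P"
    by (rule quotient)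
      (use square(2) exch_act in \<open>auto simp: exch act_total d\<tau>_total proj_act proj_d\<tau> minus_one simp del: o_apply\<close>)

  \<comment> \<open>The factor -1 passes from the frame to the coordinate, since
    \<open>\<rho> (- cl_one)\<close> negates vectors. The sign condition of the second part thus
    becomes plain invariance under the composite lift.\<close>
  have lift_exch: "pinor_scale \<epsilon> \<rho> P (-1) (pinor_lift d\<tau> S) = pinor_lift (d\<tau> \<circ> sheet_exchange P) S"
    if "S \<in> pinor_fibre \<epsilon> \<rho> P x" for S x
  proof -
    obtain p v where p: "p \<in> total P" and S: "S = pinor \<epsilon> \<rho> P p v"
      using \<open>S \<in> _\<close> unfolding pinor_fibre_def by blast
    have "pinor_lift (d\<tau> \<circ> sheet_exchange P) S = pinor \<epsilon> \<rho> P (act P (d\<tau> p) (- cl_one)) v"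
      unfolding S using pinor_lift_pinor[of p "d\<tau> \<circ> sheet_exchange P", OF p exch_act[OF p]]
      by (simp only: exch[OF p])
    also have "\<dots> = pinor \<epsilon> \<rho> P (d\<tau> p) (- v)"
      using p by (simp add: pinor_act d\<tau>_total minus_one rho_minus_one)
    also have "\<dots> = pinor_scale \<epsilon> \<rho> P (-1) (pinor_lift d\<tau> S)"
    proof -
      have "(-1) *s v = - v" by (simp add: vec_eq_iff)
      moreover have "pinor_lift d\<tau> S = pinor \<epsilon> \<rho> P (d\<tau> p) v"
        unfolding S by (rule pinor_lift_pinor[OF p d\<tau>_act[OF p]])
      ultimately show ?thesis using pinor_scale_pinor[OF d\<tau>_total[OF p], of "-1" v] by simp
    qed
    finally show ?thesis by (rule sym)
  qed
  have "pinor_scale \<epsilon> \<rho> P (-1) (pinor_lift d\<tau> (s (\<tau> x))) = pinor_lift (d\<tau> \<circ> sheet_exchange P) (s (\<tau> x))"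
    if "s \<in> pinor_sections \<epsilon> \<rho> X' P" "x \<in> pts X'" for s x
    using that \<tau> by (intro lift_exch[of _ "\<tau> x"]) (simp add: pinor_sections_iff)
  \<comment> \<open>The rewriting is applied to the value at \<open>\<tau> x\<close>, a pinor in the
    fibre over \<open>\<tau> x\<close>, for sections already known to lie in
    \<open>pinor_sections\<close>.\<close>
  then have V: "{s \<in> pinor_sections \<epsilon> \<rho> X' P.
      \<forall>x\<in>pts X'. s x = pinor_scale \<epsilon> \<rho> P (-1) (pinor_lift d\<tau> (s (\<tau> x)))} = B.invariant_sections"
    unfolding B.invariant_sections_def by auto
  show ?thesis
    unfolding Let_def V A.invariant_sections_def[symmetric]
    using A.push_section_linear_iso A.push_section_induced B.push_section_linear_iso B.push_section_induced
    by blast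
qed

end
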